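(* Any contraction of class $\mathcal{Q}$ is subnormal; that is, if $T\in B(\mathcal{H})$ is an operator of class $\mathcal{Q}$ on a complex Hilbert space $\mathcal{H}$ and $T^*T\leqslant I$, then $T$ is subnormal.
   Context: $B(\mathcal{H},\mathcal{K})$ denotes the bounded linear operators between complex Hilbert spaces, $B(\mathcal{H})=B(\mathcal{H},\mathcal{H})$. An operator $T\in B(\mathcal{H})$ is of class $\mathcal{Q}$ if there is an orthogonal decomposition $\mathcal{H}=\mathcal{H}_1\oplus\mathcal{H}_2$ with $\mathcal{H}_1\neq\{0\}$, $\mathcal{H}_2\neq\{0\}$, relative to which $T=\begin{bmatrix} V & E\\ 0 & Q\end{bmatrix}$ with $V\in B(\mathcal{H}_1)$, $E\in B(\mathcal{H}_2,\mathcal{H}_1)$, $Q\in B(\mathcal{H}_2)$ satisfying $V^*V=I$, $V^*E=0$, $QE^*E=E^*EQ$, and $Q$ is quasinormal, i.e. $QQ^*Q=Q^*QQ$. $T\in B(\mathcal{H})$ is subnormal if it is the restriction to $\mathcal{H}$ of a normal operator $N\in B(\mathcal{K})$ on some complex Hilbert space $\mathcal{K}\supseteq\mathcal{H}$ (isometric embedding), $Th=Nh$ for $h\in\mathcal H$. *)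

theory Defs
  imports "HOL-Analysis.Analysis" "HOL-Library.Function_Algebras"
begin

class complex_vector = ab_group_add +
  fixes scaleC :: "complex \<Rightarrow> 'a \<Rightarrow> 'a"  (infixr \<open>*\<^sub>C\<close> 75)
  assumes scaleC_add_right: "a *\<^sub>C (x + y) = a *\<^sub>C x + a *\<^sub>C y"
    and scaleC_add_left: "(a + b) *\<^sub>C x = a *\<^sub>C x + b *\<^sub>C x"
    and scaleC_scaleC: "a *\<^sub>C (b *\<^sub>C x) = (a * b) *\<^sub>C x"
    and scaleC_one: "1 *\<^sub>C x = x"

global_interpretation complex_vector: vector_space "scaleC :: complex \<Rightarrow> 'a \<Rightarrow> 'a::complex_vector"
  by unfold_locales (fact scaleC_add_right scaleC_add_left scaleC_scaleC scaleC_one)+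

instantiation complex :: complex_vector
begin
definition scaleC_complex :: "complex \<Rightarrow> complex \<Rightarrow> complex" where
  "scaleC_complex c x = c * x"
instance
  by standard (simp_all add: scaleC_complex_def algebra_simps)
end

instantiation "fun" :: (type, complex_vector) complex_vector
begin
definition scaleC_fun :: "complex \<Rightarrow> ('a \<Rightarrow> 'b) \<Rightarrow> 'a \<Rightarrow> 'b" where
  "scaleC_fun c f = (\<lambda>x. c *\<^sub>C f x)"
instance
  by standard (simp_all add: scaleC_fun_def fun_eq_iff complex_vector.scale_right_distrib
      complex_vector.scale_left_distrib)
end

text \<open>
  A Hilbert space is a pair of a linear subspace \<open>H\<close> of some complex vector space, serving as the
  carrier, and an inner product \<open>ip\<close> (linear in the first argument) whose values matter only
  on \<open>H\<close>. The ambient space carries no topology. In this way the subspaces occurring in an orthogonal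
  decomposition, and the Hilbert space on which a normal extension acts, are Hilbert spaces in the
  same sense as \<open>H\<close> itself.
\<close>

definition hnorm :: "('v \<Rightarrow> 'v \<Rightarrow> complex) \<Rightarrow> 'v \<Rightarrow> real" where
  "hnorm ip x = sqrt (Re (ip x x))"

locale complex_hilbert_space =
  fixes H :: "'v::complex_vector set" and ip :: "'v \<Rightarrow> 'v \<Rightarrow> complex"
  assumes subspace: "complex_vector.subspace H"
    and ip_add_left: "\<lbrakk>x \<in> H; y \<in> H; z \<in> H\<rbrakk> \<Longrightarrow> ip (x + y) z = ip x z + ip y z"
    and ip_scaleC_left: "\<lbrakk>x \<in> H; y \<in> H\<rbrakk> \<Longrightarrow> ip (c *\<^sub>C x) y = c * ip x y"
    and ip_commute: "\<lbrakk>x \<in> H; y \<in> H\<rbrakk> \<Longrightarrow> ip y x = cnj (ip x y)"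
    and ip_pos: "\<lbrakk>x \<in> H; x \<noteq> 0\<rbrakk> \<Longrightarrow> 0 < Re (ip x x)"
    and complete: "\<lbrakk>\<And>n. \<sigma> n \<in> H;
        \<And>e. 0 < e \<Longrightarrow> \<exists>N. \<forall>m\<ge>N. \<forall>n\<ge>N. hnorm ip (\<sigma> m - \<sigma> n) < e\<rbrakk>
      \<Longrightarrow> \<exists>x\<in>H. (\<lambda>n. hnorm ip (\<sigma> n - x)) \<longlonglongrightarrow> 0"

text \<open>Operators are total functions, of which only the values on the carrier matter.\<close>

definition bounded_operators ::
  "'v::complex_vector set \<Rightarrow> ('v \<Rightarrow> 'v \<Rightarrow> complex) \<Rightarrow>
   'w::complex_vector set \<Rightarrow> ('w \<Rightarrow> 'w \<Rightarrow> complex) \<Rightarrow> ('v \<Rightarrow> 'w) set" where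
  "bounded_operators H ip K ip' = {T.
     (\<forall>x\<in>H. T x \<in> K) \<and>
     (\<forall>x\<in>H. \<forall>y\<in>H. T (x + y) = T x + T y) \<and>
     (\<forall>c. \<forall>x\<in>H. T (c *\<^sub>C x) = c *\<^sub>C T x) \<and>
     (\<exists>C. \<forall>x\<in>H. hnorm ip' (T x) \<le> C * hnorm ip x)}"

text \<open>For bounded operators between Hilbert spaces the adjoint exists and is unique on \<open>K\<close>.\<close>

definition hadjoint ::
  "'v::complex_vector set \<Rightarrow> ('v \<Rightarrow> 'v \<Rightarrow> complex) \<Rightarrow>
   'w::complex_vector set \<Rightarrow> ('w \<Rightarrow> 'w \<Rightarrow> complex) \<Rightarrow> ('v \<Rightarrow> 'w) \<Rightarrow> 'w \<Rightarrow> 'v" where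
  "hadjoint H ip K ip' T =
     (SOME S. S \<in> bounded_operators K ip' H ip \<and> (\<forall>x\<in>H. \<forall>y\<in>K. ip' (T x) y = ip x (S y)))"

definition normal_operator ::
  "'v::complex_vector set \<Rightarrow> ('v \<Rightarrow> 'v \<Rightarrow> complex) \<Rightarrow> ('v \<Rightarrow> 'v) \<Rightarrow> bool" where
  "normal_operator H ip N \<longleftrightarrow> N \<in> bounded_operators H ip H ip \<and>
     (let N' = hadjoint H ip H ip N in \<forall>x\<in>H. N' (N x) = N (N' x))"

definition quasinormal_operator ::
  "'v::complex_vector set \<Rightarrow> ('v \<Rightarrow> 'v \<Rightarrow> complex) \<Rightarrow> ('v \<Rightarrow> 'v) \<Rightarrow> bool" where
  "quasinormal_operator H ip Q \<longleftrightarrow> Q \<in> bounded_operators H ip H ip \<and>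
     (let Q' = hadjoint H ip H ip Q in \<forall>x\<in>H. Q (Q' (Q x)) = Q' (Q (Q x)))"

definition positive_operator ::
  "'v::complex_vector set \<Rightarrow> ('v \<Rightarrow> 'v \<Rightarrow> complex) \<Rightarrow> ('v \<Rightarrow> 'v) \<Rightarrow> bool" where
  "positive_operator H ip A \<longleftrightarrow> A \<in> bounded_operators H ip H ip \<and>
     (\<forall>x\<in>H. ip (A x) x \<in> \<real>\<^sub>\<ge>\<^sub>0)"

definition operator_le ::
  "'v::complex_vector set \<Rightarrow> ('v \<Rightarrow> 'v \<Rightarrow> complex) \<Rightarrow> ('v \<Rightarrow> 'v) \<Rightarrow> ('v \<Rightarrow> 'v) \<Rightarrow> bool" where
  "operator_le H ip A B \<longleftrightarrow> positive_operator H ip (\<lambda>x. B x - A x)"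

text \<open>
  The summands are required to be Hilbert spaces under the inner product of \<open>H\<close>,
  that is, closed subspaces of \<open>H\<close>.
\<close>

definition orthogonal_decomposition ::
  "'v::complex_vector set \<Rightarrow> ('v \<Rightarrow> 'v \<Rightarrow> complex) \<Rightarrow> 'v set \<Rightarrow> 'v set \<Rightarrow> bool" where
  "orthogonal_decomposition H ip H1 H2 \<longleftrightarrow>
     complex_hilbert_space H1 ip \<and> complex_hilbert_space H2 ip \<and>
     H = {x + y | x y. x \<in> H1 \<and> y \<in> H2} \<and>
     (\<forall>x\<in>H1. \<forall>y\<in>H2. ip x y = 0)"

definition class_Q ::
  "'v::complex_vector set \<Rightarrow> ('v \<Rightarrow> 'v \<Rightarrow> complex) \<Rightarrow> ('v \<Rightarrow> 'v) \<Rightarrow> bool" where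
  "class_Q H ip T \<longleftrightarrow> T \<in> bounded_operators H ip H ip \<and>
     (\<exists>H1 H2 V E Q.
        orthogonal_decomposition H ip H1 H2 \<and> H1 \<noteq> {0} \<and> H2 \<noteq> {0} \<and>
        V \<in> bounded_operators H1 ip H1 ip \<and>
        E \<in> bounded_operators H2 ip H1 ip \<and>
        Q \<in> bounded_operators H2 ip H2 ip \<and>
        (\<forall>x\<in>H1. \<forall>y\<in>H2. T (x + y) = (V x + E y) + Q y) \<and>
        (let V' = hadjoint H1 ip H1 ip V; E' = hadjoint H2 ip H1 ip E in
           (\<forall>x\<in>H1. V' (V x) = x) \<and>
           (\<forall>y\<in>H2. V' (E y) = 0) \<and>
           (\<forall>y\<in>H2. Q (E' (E y)) = E' (E (Q y)))) \<and>
        quasinormal_operator H2 ip Q)"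

definition isometric_embedding ::
  "'v::complex_vector set \<Rightarrow> ('v \<Rightarrow> 'v \<Rightarrow> complex) \<Rightarrow>
   'w::complex_vector set \<Rightarrow> ('w \<Rightarrow> 'w \<Rightarrow> complex) \<Rightarrow> ('v \<Rightarrow> 'w) \<Rightarrow> bool" where
  "isometric_embedding H ip K ip' J \<longleftrightarrow> J \<in> bounded_operators H ip K ip' \<and>
     (\<forall>x\<in>H. \<forall>y\<in>H. ip' (J x) (J y) = ip x y)"

text \<open>
  HOL cannot quantify over the type of the space \<open>K\<close> of the normal extension, so its carrier is taken
  to be a linear space of functions \<open>nat \<Rightarrow> 'v \<Rightarrow> complex\<close>, with an arbitrary inner product. Nothing is
  lost. Let \<open>N\<close> be a normal extension of \<open>T\<close> on a Hilbert space \<open>K\<close> over any other type, with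
  embedding \<open>J\<close> and adjoint \<open>N*\<close>. The closed linear span of all \<open>(N*)^n (J h)\<close> contains \<open>J ` H\<close> and
  reduces \<open>N\<close>, so \<open>N\<close> may be restricted to it. A vector \<open>k\<close> in this span is determined by the
  function sending \<open>n\<close> and \<open>h\<close> to the inner product of \<open>k\<close> with \<open>(N*)^n (J h)\<close> (for \<open>h \<in> H\<close>, and to \<open>0\<close>
  otherwise). This function depends linearly on \<open>k\<close>, so the whole structure can be transported along it.
\<close>

definition subnormal_operator ::
  "'v::complex_vector set \<Rightarrow> ('v \<Rightarrow> 'v \<Rightarrow> complex) \<Rightarrow> ('v \<Rightarrow> 'v) \<Rightarrow> bool" where
  "subnormal_operator H ip T \<longleftrightarrow> T \<in> bounded_operators H ip H ip \<and>
     (\<exists>(K :: (nat \<Rightarrow> 'v \<Rightarrow> complex) set) ip' J N.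
        complex_hilbert_space K ip' \<and>
        isometric_embedding H ip K ip' J \<and>
        normal_operator K ip' N \<and>
        (\<forall>h\<in>H. J (T h) = N (J h)))"

end

theory Submission
  imports Defs
begin

text \<open>
  By Bram and Halmos, a contraction \<open>T\<close> is subnormal as soon as \<open>\<Sum>i,j. (T^i h_j, T^j h_i) \<ge> 0\<close> for all
  finite sequences \<open>h\<close>. Split the inner product into the asymptotic form \<open>lim_n (T^n x, T^n y)\<close> and
  the remaining defect form. For the asymptotic form \<open>T\<close> is an isometry, so its part of the kernel
  is a square. The defect form vanishes on \<open>H1\<close>, where \<open>T\<close> is isometric; on \<open>H2\<close> it turns \<open>T\<close> into
  \<open>Q\<close>, and by the commutation relations of class \<open>Q\<close> the operator \<open>Q*\<close> is still an adjoint of \<open>Q\<close>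
  for it. So \<open>Q\<close> is quasinormal for the defect form, and the kernel is nonnegative there by
  induction, using hyponormality of \<open>Q\<close>.
\<close>

section \<open>Semi-inner products\<close>

text \<open>\<open>T\<close> itself need not be quasinormal; only its corner \<open>Q\<close> is.
  Subtracting the asymptotic form removes \<open>H1\<close> and the coupling \<open>E\<close> at
  once: a vector whose norm is preserved by all powers of \<open>T\<close> has defect norm 0, and
  Cauchy-Schwarz then kills every mixed term. The corner keeps its adjoint because on
  \<open>H2\<close> one has (T^(k+1) y, T^(k+1) y') = (E y, E y') + (T^k Q y, T^k Q y'). Since
  \<open>Q\<close> commutes with E'E and with Q'Q, the primes denoting adjoints, the adjoint
  relation passes from k to k+1 and then to the limit. The price is that the forms may be degenerate
  and the spaces incomplete for them, so polar decompositions and projections are out of reach.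
  Hence everything before the final completion is phrased for semi-inner products with a prescribed
  adjoint. Contractivity makes the limit exist, makes the defect form nonnegative, and bounds the
  powers of the future extension; log-convexity then turns that bound into contractivity of the
  extension.\<close>

locale semi_inner_space =
  fixes D :: "'d::complex_vector set" and s :: "'d \<Rightarrow> 'd \<Rightarrow> complex"
  assumes subspace_D: "complex_vector.subspace D"
    and s_add_left: "\<lbrakk>x \<in> D; y \<in> D; z \<in> D\<rbrakk> \<Longrightarrow> s (x + y) z = s x z + s y z"
    and s_scale_left: "\<lbrakk>x \<in> D; y \<in> D\<rbrakk> \<Longrightarrow> s (c *\<^sub>C x) y = c * s x y"
    and s_commute: "\<lbrakk>x \<in> D; y \<in> D\<rbrakk> \<Longrightarrow> s y x = cnj (s x y)"
    and s_nonneg: "x \<in> D \<Longrightarrow> 0 \<le> Re (s x x)"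
begin

lemma D_zero [simp]: "0 \<in> D"
  and D_add [simp]: "x \<in> D \<Longrightarrow> y \<in> D \<Longrightarrow> x + y \<in> D"
  and D_scale [simp]: "x \<in> D \<Longrightarrow> c *\<^sub>C x \<in> D"
  and D_diff [simp]: "x \<in> D \<Longrightarrow> y \<in> D \<Longrightarrow> x - y \<in> D"
  and D_sum: "(\<And>i. i \<in> I \<Longrightarrow> f i \<in> D) \<Longrightarrow> sum f I \<in> D"
  using subspace_D
  by (auto intro: complex_vector.subspace_0 complex_vector.subspace_add
      complex_vector.subspace_scale complex_vector.subspace_diff complex_vector.subspace_sum)

lemma s_add_right: "\<lbrakk>x \<in> D; y \<in> D; z \<in> D\<rbrakk> \<Longrightarrow> s z (x + y) = s z x + s z y"
  by (metis D_add complex_cnj_add s_add_left s_commute)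

lemma s_scale_right: "\<lbrakk>x \<in> D; y \<in> D\<rbrakk> \<Longrightarrow> s y (c *\<^sub>C x) = cnj c * s y x"
  by (metis D_scale complex_cnj_mult s_commute s_scale_left)

lemma s_zero_left [simp]: "x \<in> D \<Longrightarrow> s 0 x = 0"
  using s_add_left[of 0 0 x] by simp

lemma s_zero_right [simp]: "x \<in> D \<Longrightarrow> s x 0 = 0"
  using s_add_right[of 0 0 x] by simp

lemma s_diff_left: "\<lbrakk>x \<in> D; y \<in> D; z \<in> D\<rbrakk> \<Longrightarrow> s (x - y) z = s x z - s y z"
  using s_add_left[of "x - y" y z] by simp

lemma s_diff_right: "\<lbrakk>x \<in> D; y \<in> D; z \<in> D\<rbrakk> \<Longrightarrow> s z (x - y) = s z x - s z y"
  using s_add_right[of "x - y" y z] by simp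

lemma s_sum_left:
  "\<lbrakk>\<And>i. i \<in> I \<Longrightarrow> f i \<in> D; z \<in> D\<rbrakk> \<Longrightarrow> s (sum f I) z = (\<Sum>i\<in>I. s (f i) z)"
  by (induction I rule: infinite_finite_induct) (auto simp: s_add_left D_sum)

lemma s_sum_right:
  "\<lbrakk>\<And>i. i \<in> I \<Longrightarrow> f i \<in> D; z \<in> D\<rbrakk> \<Longrightarrow> s z (sum f I) = (\<Sum>i\<in>I. s z (f i))"
  by (induction I rule: infinite_finite_induct) (auto simp: s_add_right D_sum)

lemma s_Im_self: "x \<in> D \<Longrightarrow> Im (s x x) = 0"
  using s_commute[of x x] by (metis Reals_cnj_iff complex_is_Real_iff)

lemma hnorm_sq: "x \<in> D \<Longrightarrow> (hnorm s x)\<^sup>2 = Re (s x x)"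
  by (simp add: hnorm_def s_nonneg)

lemma hnorm_nonneg: "x \<in> D \<Longrightarrow> 0 \<le> hnorm s x"
  by (simp add: hnorm_def s_nonneg)

lemma s_self: "x \<in> D \<Longrightarrow> s x x = of_real ((hnorm s x)\<^sup>2)"
  by (simp add: complex_eq_iff s_Im_self hnorm_sq)

lemma norm_sq_add:
  assumes "x \<in> D" "y \<in> D"
  shows "Re (s (x + y) (x + y)) = Re (s x x) + 2 * Re (s x y) + Re (s y y)"
  using assms s_commute[of x y] by (simp add: s_add_left s_add_right)

lemma norm_sq_diff:
  assumes "x \<in> D" "y \<in> D"
  shows "Re (s (x - y) (x - y)) = Re (s x x) - 2 * Re (s x y) + Re (s y y)"
  using assms s_commute[of x y] by (simp add: s_diff_left s_diff_right)

text \<open>Expanding the square of \<open>x - t * s x y * y\<close> gives a nonnegative polynomial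
  in the real \<open>t\<close>. As \<open>y\<close> may be a nonzero null vector, the usual
  \<open>t = 1 / s y y\<close> covers only one case.\<close>

lemma cauchy_schwarz_sq:
  assumes x: "x \<in> D" and y: "y \<in> D"
  shows "(cmod (s x y))\<^sup>2 \<le> Re (s x x) * Re (s y y)"
proof -
  let ?z = "s x y" and ?X = "Re (s x x)" and ?Y = "Re (s y y)"
  have key: "0 \<le> ?X - 2 * t * (cmod ?z)\<^sup>2 + t\<^sup>2 * (cmod ?z)\<^sup>2 * ?Y" for t :: real
  proof -
    let ?w = "(of_real t * ?z) *\<^sub>C y"
    have "0 \<le> Re (s (x - ?w) (x - ?w))"
      using x y by (simp add: s_nonneg)
    also have "\<dots> = ?X - 2 * Re (s x ?w) + Re (s ?w ?w)"
      using x y by (simp add: norm_sq_diff)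
    also have "s x ?w = of_real (t * (cmod ?z)\<^sup>2)"
      using x y complex_norm_square[of ?z] by (simp add: s_scale_right mult_ac)
    also have "s ?w ?w = of_real (t\<^sup>2 * (cmod ?z)\<^sup>2 * ?Y)"
      using x y complex_norm_square[of ?z] s_self[OF y] hnorm_sq[OF y]
      by (simp add: s_scale_right s_scale_left mult_ac power2_eq_square)
    finally show ?thesis by simp
  qed
  show ?thesis
  proof (cases "?Y = 0")
    case True
    have "(cmod ?z)\<^sup>2 \<le> 0"
    proof (rule ccontr)
      assume "\<not> (cmod ?z)\<^sup>2 \<le> 0"
      then have "(cmod ?z)\<^sup>2 > 0" by simp
      \<comment> \<open>For a null vector \<open>y\<close> the polynomial is affine in
        \<open>t\<close>; this \<open>t\<close> would make it equal to
        \<open>- ?X - 2\<close>.\<close>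
      moreover have "0 \<le> ?X - 2 * ((?X + 1) / (cmod ?z)\<^sup>2) * (cmod ?z)\<^sup>2"
        using key[of "(?X + 1) / (cmod ?z)\<^sup>2"] True by simp
      ultimately have "0 \<le> ?X - 2 * (?X + 1)" by simp
      then show False using s_nonneg[OF x] by simp
    qed
    then show ?thesis using True by simp
  next
    case False
    then have pos: "?Y > 0" using s_nonneg[OF y] by simp
    from key[of "1 / ?Y"] pos have "0 \<le> ?X - (cmod ?z)\<^sup>2 / ?Y"
      by (simp add: power2_eq_square field_simps)
    then show ?thesis using pos by (simp add: field_simps)
  qed
qed

lemma cauchy_schwarz:
  assumes "x \<in> D" "y \<in> D"
  shows "cmod (s x y) \<le> hnorm s x * hnorm s y"
proof (rule power2_le_imp_le)
  show "(cmod (s x y))\<^sup>2 \<le> (hnorm s x * hnorm s y)\<^sup>2"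
    using cauchy_schwarz_sq[OF assms] assms by (simp add: power_mult_distrib hnorm_sq)
  show "0 \<le> hnorm s x * hnorm s y"
    using assms by (simp add: hnorm_nonneg)
qed

lemma hnorm_triangle:
  assumes "x \<in> D" "y \<in> D"
  shows "hnorm s (x + y) \<le> hnorm s x + hnorm s y"
proof (rule power2_le_imp_le)
  have "Re (s x y) \<le> hnorm s x * hnorm s y"
    using cauchy_schwarz[OF assms] complex_Re_le_cmod[of "s x y"] by simp
  then show "(hnorm s (x + y))\<^sup>2 \<le> (hnorm s x + hnorm s y)\<^sup>2"
    using assms by (simp add: hnorm_sq norm_sq_add power2_sum)
qed (use assms in \<open>simp add: hnorm_nonneg\<close>)

lemma hnorm_scale:
  assumes x: "x \<in> D"
  shows "hnorm s (c *\<^sub>C x) = cmod c * hnorm s x"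
proof -
  have "s (c *\<^sub>C x) (c *\<^sub>C x) = (c * cnj c) * s x x"
    using x by (simp add: s_scale_left s_scale_right)
  also have "c * cnj c = of_real ((cmod c)\<^sup>2)"
    using complex_norm_square[of c] by simp
  finally have "Re (s (c *\<^sub>C x) (c *\<^sub>C x)) = (cmod c)\<^sup>2 * Re (s x x)"
    by (simp del: of_real_power)
  then show ?thesis
    by (simp add: hnorm_def real_sqrt_mult)
qed

lemma hnorm_minus_commute:
  assumes "x \<in> D" "y \<in> D"
  shows "hnorm s (x - y) = hnorm s (y - x)"
  using hnorm_scale[of "y - x" "-1"] assms
  by (simp add: complex_vector.scale_minus_left[symmetric] complex_vector.scale_minus_left)

lemma hnorm_triangle_diff:
  assumes "x \<in> D" "y \<in> D" "z \<in> D"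
  shows "hnorm s (x - z) \<le> hnorm s (x - y) + hnorm s (y - z)"
  using hnorm_triangle[of "x - y" "y - z"] assms by simp

lemma hnorm_diff_le: "\<lbrakk>x \<in> D; y \<in> D\<rbrakk> \<Longrightarrow> \<bar>hnorm s x - hnorm s y\<bar> \<le> hnorm s (x - y)"
  using hnorm_triangle[of "x - y" y] hnorm_triangle[of "y - x" x] hnorm_minus_commute[of x y]
  by simp

lemma hnorm_zero [simp]: "hnorm s 0 = 0"
  by (simp add: hnorm_def)

lemma s_tendsto_left:
  assumes "\<And>n. \<sigma> n \<in> D" "x \<in> D" "y \<in> D" "(\<lambda>n. hnorm s (\<sigma> n - x)) \<longlonglongrightarrow> 0"
  shows "(\<lambda>n. s (\<sigma> n) y) \<longlonglongrightarrow> s x y"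
proof -
  have "(\<lambda>n. s (\<sigma> n - x) y) \<longlonglongrightarrow> 0"
  proof (rule Lim_null_comparison)
    show "\<forall>\<^sub>F n in sequentially. norm (s (\<sigma> n - x) y) \<le> hnorm s (\<sigma> n - x) * hnorm s y"
      using assms by (simp add: cauchy_schwarz)
    show "(\<lambda>n. hnorm s (\<sigma> n - x) * hnorm s y) \<longlonglongrightarrow> 0"
      using tendsto_mult_left_zero[OF assms(4)] .
  qed
  then show ?thesis
    using assms by (simp add: s_diff_left LIM_zero_iff)
qed

lemma polarization:
  assumes "x \<in> D" "y \<in> D"
  shows "s x y = (\<Sum>c\<leftarrow>[1, - 1, \<i>, - \<i>]. c * s (x + c *\<^sub>C y) (x + c *\<^sub>C y)) / 4"
  using assms
  by (simp add: s_add_left s_add_right s_scale_left s_scale_right algebra_simps)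

text \<open>Reduces existence of a limit to the diagonal. It serves twice: for the asymptotic form,
  where the diagonal decreases, and for the completion, where the norms are Cauchy.\<close>

lemma convergent_polarization:
  assumes "\<And>n. \<sigma> n \<in> D" "\<And>n. \<tau> n \<in> D"
    and "\<And>c. convergent (\<lambda>n. s (\<sigma> n + c *\<^sub>C \<tau> n) (\<sigma> n + c *\<^sub>C \<tau> n))"
  shows "convergent (\<lambda>n. s (\<sigma> n) (\<tau> n))"
proof -
  let ?q = "\<lambda>c n. s (\<sigma> n + c *\<^sub>C \<tau> n) (\<sigma> n + c *\<^sub>C \<tau> n)"
  have "\<exists>l. ?q c \<longlonglongrightarrow> l" for c
    using assms(3) by (simp add: convergent_def)
  then obtain l where l: "\<And>c. ?q c \<longlonglongrightarrow> l c" by metis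
  have "(\<lambda>n. (1 * ?q 1 n + (- 1 * ?q (- 1) n + (\<i> * ?q \<i> n + - \<i> * ?q (- \<i>) n))) / 4)
      \<longlonglongrightarrow> (1 * l 1 + (- 1 * l (- 1) + (\<i> * l \<i> + - \<i> * l (- \<i>)))) / 4"
    by (intro tendsto_intros l) simp
  moreover have "(\<lambda>n. s (\<sigma> n) (\<tau> n))
      = (\<lambda>n. (1 * ?q 1 n + (- 1 * ?q (- 1) n + (\<i> * ?q \<i> n + - \<i> * ?q (- \<i>) n))) / 4)"
    by (rule ext, subst polarization[OF assms(1,2)]) (simp only: list.map sum_list.Cons sum_list.Nil add_0_right)
  ultimately show ?thesis unfolding convergent_def by metis
qed

text \<open>Substitute for definiteness: a null vector is orthogonal to everything. This is what
  lets the defect form ignore \<open>H1\<close> and makes the completion independent of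
  representatives.\<close>

lemma s_null_left:
  assumes "x \<in> D" "y \<in> D" "Re (s x x) = 0"
  shows "s x y = 0"
  using cauchy_schwarz_sq[OF assms(1,2)] assms(3) by simp

end

lemma semi_inner_space_subspace:
  assumes "semi_inner_space D s" "complex_vector.subspace D'" "D' \<subseteq> D"
  shows "semi_inner_space D' s"
proof -
  interpret semi_inner_space D s by (rule assms(1))
  show ?thesis
    using assms(2,3)
    by unfold_locales (auto intro: s_add_left s_scale_left s_commute s_nonneg)
qed

sublocale complex_hilbert_space \<subseteq> semi_inner_space H ip
proof
  show "x \<in> H \<Longrightarrow> 0 \<le> Re (ip x x)" for x
  proof (cases "x = 0")
    case True
    have "ip 0 0 = 0"
      using ip_add_left[of 0 0 0] subspace complex_vector.subspace_0 by force
    then show ?thesis using True by simp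
  qed (use ip_pos in force)
qed (fact subspace ip_add_left ip_scaleC_left ip_commute)+

section \<open>Adjoints\<close>

text \<open>First-order condition at a minimum. Dividing by \<open>X + 1\<close> instead of
  \<open>X\<close> keeps the test point defined when \<open>X = 0\<close>.\<close>

lemma quadratic_nonneg_imp_linear_zero:
  fixes X d :: real
  assumes X: "0 \<le> X" and quad: "\<And>t. 0 \<le> t\<^sup>2 * X + 2 * t * d"
  shows "d = 0"
proof -
  define u where "u = d / (X + 1)"
  have d: "d = u * (X + 1)" using X by (simp add: u_def)
  have "0 \<le> u\<^sup>2 * X + 2 * (- u) * d" using quad[of "- u"] by simp
  also have "\<dots> = - (u\<^sup>2 * (X + 2))" by (simp add: d power2_eq_square algebra_simps)
  finally have "u\<^sup>2 \<le> 0" using X by (simp add: mult_le_0_iff)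
  then show ?thesis by (simp add: d)
qed


context complex_hilbert_space
begin

lemma ip_eq_imp_eq:
  assumes "x \<in> H" "y \<in> H" "\<And>z. z \<in> H \<Longrightarrow> ip z x = ip z y"
  shows "x = y"
proof (rule ccontr)
  assume "x \<noteq> y"
  then have "0 < Re (ip (x - y) (x - y))"
    using assms by (simp add: ip_pos)
  then show False using assms by (simp add: s_diff_right)
qed

text \<open>Variational proof: for the vector \<open>u\<close> sought, \<open>\<phi> x\<close>
  equals the squared distance from \<open>x\<close> to \<open>u\<close> minus the squared norm of
  \<open>u\<close>, so \<open>u\<close> is found as the limit of a minimizing sequence of
  \<open>\<phi>\<close>.\<close>

lemma riesz:
  assumes add: "\<And>x y. x \<in> H \<Longrightarrow> y \<in> H \<Longrightarrow> f (x + y) = f x + f y"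
    and scale: "\<And>c x. x \<in> H \<Longrightarrow> f (c *\<^sub>C x) = c * f x"
    and bound: "\<And>x. x \<in> H \<Longrightarrow> cmod (f x) \<le> C * hnorm ip x"
  shows "\<exists>u\<in>H. \<forall>x\<in>H. f x = ip x u"
proof -
  define \<phi> where "\<phi> x = Re (ip x x) - 2 * Re (f x)" for x
  have lower: "- C\<^sup>2 \<le> \<phi> x" if "x \<in> H" for x
  proof -
    have "Re (f x) \<le> C * hnorm ip x"
      using bound[OF that] complex_Re_le_cmod[of "f x"] by linarith
    moreover have "0 \<le> (hnorm ip x - C)\<^sup>2" by simp
    ultimately show ?thesis
      using hnorm_sq[OF that] by (simp add: \<phi>_def power2_diff algebra_simps)
  qed
  define m where "m = Inf (\<phi> ` H)"
  have bdd: "bdd_below (\<phi> ` H)" by (rule bdd_belowI2) (rule lower)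
  have m_le: "m \<le> \<phi> x" if "x \<in> H" for x
    unfolding m_def using bdd that by (simp add: cInf_lower)
  have ex: "\<exists>x\<in>H. \<phi> x < m + 1 / real (Suc n)" for n
  proof -
    have "Inf (\<phi> ` H) < m + 1 / real (Suc n)" unfolding m_def by simp
    then show ?thesis using bdd D_zero by (subst (asm) cInf_less_iff) (auto simp del: D_zero)
  qed
  then obtain \<sigma> where \<sigma>: "\<And>n. \<sigma> n \<in> H" "\<And>n. \<phi> (\<sigma> n) < m + 1 / real (Suc n)"
    by metis
  \<comment> \<open>Parallelogram law; the linear parts of \<open>\<phi>\<close> cancel. It forces
    minimizing sequences to be Cauchy.\<close>
  have par: "Re (ip (x - y) (x - y)) = 2 * \<phi> x + 2 * \<phi> y - 4 * \<phi> ((1/2) *\<^sub>C (x + y))"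
    if "x \<in> H" "y \<in> H" for x y
  proof -
    have "Re (ip ((1/2) *\<^sub>C (x + y)) ((1/2) *\<^sub>C (x + y))) = Re (ip (x + y) (x + y)) / 4"
      using that by (simp add: s_scale_left s_scale_right)
    moreover have "Re (f ((1/2) *\<^sub>C (x + y))) = (Re (f x) + Re (f y)) / 2"
      using that by (simp add: scale add)
    ultimately show ?thesis
      using that by (simp add: \<phi>_def norm_sq_diff norm_sq_add)
  qed
  have cauchy: "(hnorm ip (\<sigma> k - \<sigma> n))\<^sup>2 \<le> 2 / real (Suc k) + 2 / real (Suc n)" for k n
  proof -
    have "(hnorm ip (\<sigma> k - \<sigma> n))\<^sup>2
        = 2 * \<phi> (\<sigma> k) + 2 * \<phi> (\<sigma> n) - 4 * \<phi> ((1/2) *\<^sub>C (\<sigma> k + \<sigma> n))"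
      using \<sigma> by (simp add: hnorm_sq par)
    also have "\<dots> \<le> 2 * (m + 1 / real (Suc k)) + 2 * (m + 1 / real (Suc n)) - 4 * m"
      using \<sigma>(2)[of k] \<sigma>(2)[of n] m_le[of "(1/2) *\<^sub>C (\<sigma> k + \<sigma> n)"] \<sigma>(1) by fastforce
    finally show ?thesis by simp
  qed
  have "\<exists>u\<in>H. (\<lambda>n. hnorm ip (\<sigma> n - u)) \<longlonglongrightarrow> 0"
  proof (rule complete)
    fix e :: real assume e: "0 < e"
    obtain N where N: "4 / e\<^sup>2 < real N" using reals_Archimedean2 by blast
    have "hnorm ip (\<sigma> k - \<sigma> n) < e" if "N \<le> k" "N \<le> n" for k n
    proof (rule power2_less_imp_less)
      have "2 / real (Suc k) + 2 / real (Suc n) \<le> 2 / real (Suc N) + 2 / real (Suc N)"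
        using that by (intro add_mono divide_left_mono) auto
      also have "\<dots> = 4 / real (Suc N)" by simp
      also have "\<dots> < e\<^sup>2" using N e by (simp add: field_simps add_strict_increasing)
      finally show "(hnorm ip (\<sigma> k - \<sigma> n))\<^sup>2 < e\<^sup>2" using cauchy[of k n] by linarith
    qed (use e in simp)
    then show "\<exists>N. \<forall>k\<ge>N. \<forall>n\<ge>N. hnorm ip (\<sigma> k - \<sigma> n) < e" by blast
  qed (rule \<sigma>)
  then obtain u where u: "u \<in> H" "(\<lambda>n. hnorm ip (\<sigma> n - u)) \<longlonglongrightarrow> 0" by blast
  have eqRe: "Re (f x) = Re (ip u x)" if x: "x \<in> H" for x
  proof -
    let ?d = "Re (ip u x) - Re (f x)"
    have quad: "0 \<le> t\<^sup>2 * Re (ip x x) + 2 * t * ?d" for t :: real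
    proof -
      \<comment> \<open>Perturbing the almost minimal \<open>\<sigma> n\<close> by \<open>t\<close>
        times \<open>x\<close> can lower \<open>\<phi>\<close> by at most its error 1/(n+1), which
        disappears in the limit.\<close>
      have step: "- (1 / real (Suc n))
          \<le> t\<^sup>2 * Re (ip x x) + 2 * t * (Re (ip (\<sigma> n) x) - Re (f x))" for n
      proof -
        have "m \<le> \<phi> (\<sigma> n + of_real t *\<^sub>C x)"
          using \<sigma> x by (intro m_le) simp
        also have "\<dots> = \<phi> (\<sigma> n) + t\<^sup>2 * Re (ip x x) + 2 * t * (Re (ip (\<sigma> n) x) - Re (f x))"
          using \<sigma>(1)[of n] x
          by (simp add: \<phi>_def norm_sq_add add scale s_scale_left s_scale_right
              power2_eq_square algebra_simps)
        finally show ?thesis using \<sigma>(2)[of n] by linarith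
      qed
      have "(\<lambda>n. t\<^sup>2 * Re (ip x x) + 2 * t * (Re (ip (\<sigma> n) x) - Re (f x)))
          \<longlonglongrightarrow> t\<^sup>2 * Re (ip x x) + 2 * t * ?d"
        by (intro tendsto_intros s_tendsto_left u x \<sigma>)
      moreover have "(\<lambda>n. - (1 / real (Suc n))) \<longlonglongrightarrow> - 0"
        by (intro tendsto_minus) (use LIMSEQ_inverse_real_of_nat in \<open>simp add: inverse_eq_divide\<close>)
      ultimately have "- 0 \<le> t\<^sup>2 * Re (ip x x) + 2 * t * ?d"
        using step by (intro LIMSEQ_le) auto
      then show ?thesis by simp
    qed
    have X: "0 \<le> Re (ip x x)" using x by (rule s_nonneg)
    then have "?d = 0" using quad by (rule quadratic_nonneg_imp_linear_zero)
    then show ?thesis by simp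
  qed
  have "f x = ip x u" if x: "x \<in> H" for x
  proof -
    \<comment> \<open>Real parts at \<open>\<i> *\<^sub>C x\<close> are imaginary parts at
      \<open>x\<close>, up to sign.\<close>
    have "Re (f (\<i> *\<^sub>C x)) = Re (ip u (\<i> *\<^sub>C x))" using x by (simp add: eqRe)
    then have "Im (f x) = - Im (ip u x)" using x u by (simp add: scale s_scale_right)
    then show ?thesis
      using eqRe[OF x] s_commute[OF u(1) x] by (simp add: complex_eq_iff)
  qed
  then show ?thesis using u by blast
qed

end

text \<open>The choice in \<open>hadjoint\<close> is meaningful once some bounded adjoint exists;
  Riesz applied to the functionals \<open>\<lambda>x. ip' (T x) y\<close> provides one.\<close>

lemma hadjoint_spec:
  assumes H: "complex_hilbert_space H ip" and K: "complex_hilbert_space K ip'"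
    and T: "T \<in> bounded_operators H ip K ip'"
  shows "hadjoint H ip K ip' T \<in> bounded_operators K ip' H ip"
    and "\<And>x y. x \<in> H \<Longrightarrow> y \<in> K \<Longrightarrow> ip' (T x) y = ip x (hadjoint H ip K ip' T y)"
proof -
  interpret H: complex_hilbert_space H ip by (rule H)
  interpret K: complex_hilbert_space K ip' by (rule K)
  from T obtain C where maps: "\<And>x. x \<in> H \<Longrightarrow> T x \<in> K"
    and add: "\<And>x y. x \<in> H \<Longrightarrow> y \<in> H \<Longrightarrow> T (x + y) = T x + T y"
    and scale: "\<And>c x. x \<in> H \<Longrightarrow> T (c *\<^sub>C x) = c *\<^sub>C T x"
    and C: "\<And>x. x \<in> H \<Longrightarrow> hnorm ip' (T x) \<le> C * hnorm ip x"
    unfolding bounded_operators_def by blast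
  have "\<exists>u\<in>H. \<forall>x\<in>H. ip' (T x) y = ip x u" if y: "y \<in> K" for y
  proof (rule H.riesz)
    fix x assume x: "x \<in> H"
    have "cmod (ip' (T x) y) \<le> hnorm ip' (T x) * hnorm ip' y"
      using x y maps by (simp add: K.cauchy_schwarz)
    also have "\<dots> \<le> (C * hnorm ip x) * hnorm ip' y"
      using C[OF x] y by (simp add: mult_right_mono K.hnorm_nonneg)
    finally show "cmod (ip' (T x) y) \<le> (C * hnorm ip' y) * hnorm ip x"
      by (simp add: mult_ac)
  qed (use y maps in \<open>simp_all add: add scale K.s_add_left K.s_scale_left\<close>)
  then obtain S where S: "\<And>y. y \<in> K \<Longrightarrow> S y \<in> H"
    and adj: "\<And>x y. x \<in> H \<Longrightarrow> y \<in> K \<Longrightarrow> ip' (T x) y = ip x (S y)"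
    by metis
  have "S \<in> bounded_operators K ip' H ip"
    unfolding bounded_operators_def
  proof (intro CollectI conjI ballI allI)
    fix x y assume "x \<in> K" "y \<in> K"
    then show "S (x + y) = S x + S y"
      by (intro H.ip_eq_imp_eq) (simp_all add: S maps H.s_add_right K.s_add_right flip: adj)
  next
    fix c x assume "x \<in> K"
    then show "S (c *\<^sub>C x) = c *\<^sub>C S x"
      by (intro H.ip_eq_imp_eq) (simp_all add: S maps H.s_scale_right K.s_scale_right flip: adj)
  next
    \<comment> \<open>The absolute value is there because \<open>C\<close> may be negative when
      \<open>H\<close> is trivial.\<close>
    have "hnorm ip (S y) \<le> \<bar>C\<bar> * hnorm ip' y" if y: "y \<in> K" for y
    proof (cases "hnorm ip (S y) = 0")
      case True
      then show ?thesis using y by (simp add: K.hnorm_nonneg)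
    next
      case False
      then have pos: "hnorm ip (S y) > 0" using H.hnorm_nonneg[OF S[OF y]] by simp
      have "(hnorm ip (S y))\<^sup>2 = Re (ip' (T (S y)) y)"
        using y by (simp add: H.hnorm_sq S adj)
      also have "\<dots> \<le> hnorm ip' (T (S y)) * hnorm ip' y"
        using K.cauchy_schwarz[of "T (S y)" y] complex_Re_le_cmod[of "ip' (T (S y)) y"] y S maps
        by (meson order_trans)
      also have "\<dots> \<le> (\<bar>C\<bar> * hnorm ip (S y)) * hnorm ip' y"
      proof (rule mult_right_mono)
        show "hnorm ip' (T (S y)) \<le> \<bar>C\<bar> * hnorm ip (S y)"
          using C[OF S[OF y]] pos
          by (meson abs_ge_self less_imp_le mult_right_mono order_trans)
      qed (simp add: y K.hnorm_nonneg)
      finally show ?thesis using pos by (simp add: power2_eq_square)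
    qed
    then show "\<exists>C. \<forall>x\<in>K. hnorm ip (S x) \<le> C * hnorm ip' x" by blast
  qed (rule S)
  with adj have "\<exists>S. S \<in> bounded_operators K ip' H ip \<and> (\<forall>x\<in>H. \<forall>y\<in>K. ip' (T x) y = ip x (S y))"
    by blast
  from someI_ex[OF this]
  show "hadjoint H ip K ip' T \<in> bounded_operators K ip' H ip"
    and "\<And>x y. x \<in> H \<Longrightarrow> y \<in> K \<Longrightarrow> ip' (T x) y = ip x (hadjoint H ip K ip' T y)"
    unfolding hadjoint_def by blast+
qed

section \<open>Quasinormal operators\<close>

definition linear_map :: "'v::complex_vector set \<Rightarrow> 'w::complex_vector set \<Rightarrow> ('v \<Rightarrow> 'w) \<Rightarrow> bool" where
  "linear_map D E f \<longleftrightarrow> (\<forall>x\<in>D. f x \<in> E) \<and> (\<forall>x\<in>D. \<forall>y\<in>D. f (x + y) = f x + f y) \<and>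
     (\<forall>c. \<forall>x\<in>D. f (c *\<^sub>C x) = c *\<^sub>C f x)"

lemma linear_map_mem: "linear_map D E f \<Longrightarrow> x \<in> D \<Longrightarrow> f x \<in> E"
  and linear_map_add: "linear_map D E f \<Longrightarrow> x \<in> D \<Longrightarrow> y \<in> D \<Longrightarrow> f (x + y) = f x + f y"
  and linear_map_scale: "linear_map D E f \<Longrightarrow> x \<in> D \<Longrightarrow> f (c *\<^sub>C x) = c *\<^sub>C f x"
  by (simp_all add: linear_map_def)

lemma bounded_operators_linear_map: "f \<in> bounded_operators H ip K ip' \<Longrightarrow> linear_map H K f"
  by (auto simp: linear_map_def bounded_operators_def)

lemma linear_map_diff:
  assumes f: "linear_map D E f" and D: "complex_vector.subspace D" and "x \<in> D" "y \<in> D"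
  shows "f (x - y) = f x - f y"
proof -
  have "f ((x - y) + y) = f (x - y) + f y"
    using assms by (intro linear_map_add[OF f]) (auto intro: complex_vector.subspace_diff)
  then show ?thesis by simp
qed

lemma linear_map_zero:
  assumes f: "linear_map D E f" and D: "complex_vector.subspace D"
  shows "f 0 = 0"
  using linear_map_diff[OF assms, of 0 0] D by (simp add: complex_vector.subspace_0)

lemma linear_map_sum:
  assumes f: "linear_map D E f" and D: "complex_vector.subspace D" and g: "\<And>i. i \<in> I \<Longrightarrow> g i \<in> D"
  shows "f (sum g I) = (\<Sum>i\<in>I. f (g i))"
  using g
  by (induction I rule: infinite_finite_induct)
     (simp_all add: linear_map_zero[OF f D] linear_map_add[OF f] complex_vector.subspace_sum[OF D])

lemma linear_map_funpow: "linear_map D D f \<Longrightarrow> linear_map D D (f ^^ n)"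
  by (induction n) (simp_all add: linear_map_def)

text \<open>The adjoint \<open>Q'\<close> is part of the data: for a degenerate, incomplete form an
  adjoint need neither exist nor be unique. The same pair \<open>Q\<close>, \<open>Q'\<close> has to
  serve several forms on \<open>D\<close>.\<close>

locale quasinormal_contraction = semi_inner_space D p
  for D :: "'d::complex_vector set" and p +
  fixes Q Q' :: "'d \<Rightarrow> 'd"
  assumes Q: "linear_map D D Q" and Q': "linear_map D D Q'"
    and adj: "\<lbrakk>x \<in> D; y \<in> D\<rbrakk> \<Longrightarrow> p (Q x) y = p x (Q' y)"
    and quasinormal: "x \<in> D \<Longrightarrow> Q (Q' (Q x)) = Q' (Q (Q x))"
    and contraction: "x \<in> D \<Longrightarrow> Re (p (Q x) (Q x)) \<le> Re (p x x)"
begin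

lemmas Q_mem [simp] = linear_map_mem[OF Q]
lemmas Q'_mem [simp] = linear_map_mem[OF Q']

lemma adj': "\<lbrakk>x \<in> D; y \<in> D\<rbrakk> \<Longrightarrow> p x (Q y) = p (Q' x) y"
  by (metis Q_mem Q'_mem adj s_commute)

lemma Q'_contraction:
  assumes x: "x \<in> D"
  shows "Re (p (Q' x) (Q' x)) \<le> Re (p x x)"
proof -
  let ?a = "hnorm p (Q' x)"
  have "?a\<^sup>2 = Re (p (Q (Q' x)) x)" using x by (simp add: hnorm_sq adj)
  also have "\<dots> \<le> hnorm p (Q (Q' x)) * hnorm p x"
    using cauchy_schwarz[of "Q (Q' x)" x] complex_Re_le_cmod x by (meson Q_mem Q'_mem order_trans)
  also have "\<dots> \<le> ?a * hnorm p x"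
    using x contraction[of "Q' x"] by (intro mult_right_mono) (simp_all add: s_nonneg hnorm_def)
  finally have "?a * ?a \<le> ?a * hnorm p x" by (simp add: power2_eq_square)
  then have "?a \<le> hnorm p x"
    using hnorm_nonneg[of "Q' x"] hnorm_nonneg[of x] x
    by (cases "?a = 0") (simp_all add: mult_le_cancel_left)
  then show ?thesis by (simp add: hnorm_def)
qed

text \<open>
  The iterates \<open>(1 - Q* Q)^k u\<close> tend to \<open>0\<close> for \<open>u\<close> in the range of \<open>Q*\<close>, so \<open>u\<close> is approximated
  by vectors \<open>Q* Q w\<close>; this replaces the orthogonal projection onto the closed range.
\<close>

primrec residual :: "'d \<Rightarrow> nat \<Rightarrow> 'd" where
  "residual u 0 = u"
| "residual u (Suc k) = residual u k - Q' (Q (residual u k))"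

lemma residual_mem [simp]: "u \<in> D \<Longrightarrow> residual u k \<in> D"
  by (induction k) simp_all

text \<open>Telescoping: \<open>w\<close> is the sum of the earlier residuals.\<close>

lemma residual_eq:
  assumes "u \<in> D"
  shows "\<exists>w\<in>D. u - residual u k = Q' (Q w)"
proof (induction k)
  case 0
  have "u - residual u 0 = Q' (Q 0)"
    by (simp add: linear_map_zero[OF Q subspace_D] linear_map_zero[OF Q' subspace_D])
  then show ?case using D_zero by blast
next
  case (Suc k)
  then obtain w where w: "w \<in> D" "u - residual u k = Q' (Q w)" by blast
  have "u - residual u (Suc k) = Q' (Q (w + residual u k))"
    using w assms by (simp add: linear_map_add[OF Q] linear_map_add[OF Q'] algebra_simps flip: w(2))
  then show ?case using w(1) assms by (metis D_add residual_mem)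
qed

text \<open>The step \<open>1 - Q' Q\<close> is selfadjoint for \<open>p\<close>, so iterations can
  be moved from one argument to the other.\<close>

lemma residual_shift:
  assumes "u \<in> D"
  shows "p (residual u i) (residual u j) = p u (residual u (i + j))"
proof (induction i arbitrary: j)
  case (Suc i)
  have "p (residual u (Suc i)) (residual u j) = p (residual u i) (residual u (Suc j))"
    using assms by (simp add: s_diff_left s_diff_right adj flip: adj')
  then show ?case using Suc[of "Suc j"] by simp
qed simp

text \<open>Each step lowers the squared norm of the residual \<open>e\<close> by at least that of
  \<open>Q e\<close>: the cross term subtracts it twice, and contractivity of \<open>Q'\<close>
  gives back at most one copy.\<close>

lemma residual_summable:
  assumes "u \<in> D"
  shows "(\<Sum>k<n. Re (p (Q (residual u k)) (Q (residual u k)))) + Re (p (residual u n) (residual u n))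
      \<le> Re (p u u)"
proof (induction n)
  case (Suc n)
  let ?e = "residual u n"
  have e: "?e \<in> D" using assms by simp
  have "Re (p (residual u (Suc n)) (residual u (Suc n)))
      = Re (p ?e ?e) - 2 * Re (p ?e (Q' (Q ?e))) + Re (p (Q' (Q ?e)) (Q' (Q ?e)))"
    using e by (simp add: norm_sq_diff)
  also have "p ?e (Q' (Q ?e)) = p (Q ?e) (Q ?e)" using e by (simp add: adj)
  also have "Re (p (Q' (Q ?e)) (Q' (Q ?e))) \<le> Re (p (Q ?e) (Q ?e))"
    using e by (simp add: Q'_contraction)
  finally show ?case using Suc by simp
qed simp

lemma residual_tendsto:
  assumes "u \<in> D"
  shows "(\<lambda>k. hnorm p (Q (residual u k))) \<longlonglongrightarrow> 0"
proof -
  let ?a = "\<lambda>k. Re (p (Q (residual u k)) (Q (residual u k)))"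
  have "summable ?a"
  proof (rule summableI_nonneg_bounded)
    fix n
    show "0 \<le> ?a n" using assms by (simp add: s_nonneg)
    show "(\<Sum>k<n. ?a k) \<le> Re (p u u)"
      using residual_summable[OF assms, of n] s_nonneg[of "residual u n"] assms by simp
  qed
  then have "(\<lambda>k. sqrt (?a k)) \<longlonglongrightarrow> sqrt 0"
    by (intro tendsto_real_sqrt summable_LIMSEQ_zero)
  then show ?thesis by (simp add: hnorm_def)
qed

text \<open>On vectors \<open>Q w\<close> both sides agree by quasinormality. Comparing
  \<open>z\<close> with \<open>Q w\<close> shows that the left side exceeds the right by at most the
  squared norm of \<open>Q' z - Q' (Q w)\<close>, and the residuals make this arbitrarily
  small.\<close>

lemma hyponormal:
  assumes z: "z \<in> D"
  shows "Re (p (Q' z) (Q' z)) \<le> Re (p (Q z) (Q z))"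
proof -
  let ?u = "Q' z"
  have u: "?u \<in> D" using z by simp
  \<comment> \<open>expand \<open>0 \<le> \<parallel>Q (z - Q w)\<parallel>\<^sup>2\<close> using quasinormality\<close>
  have approx: "Re (p ?u ?u) - Re (p (?u - Q' (Q w)) (?u - Q' (Q w))) \<le> Re (p (Q z) (Q z))"
    if w: "w \<in> D" for w
  proof -
    let ?v = "Q' (Q w)"
    have 1: "p (Q z) (Q (Q w)) = p ?u ?v"
    proof -
      have "p (Q z) (Q (Q w)) = p z (Q (Q' (Q w)))"
        using z w by (simp only: adj Q_mem quasinormal)
      then show ?thesis using z w by (simp add: adj')
    qed
    have 2: "p (Q (Q w)) (Q (Q w)) = p ?v ?v"
    proof -
      have "p (Q (Q w)) (Q (Q w)) = p (Q w) (Q (Q' (Q w)))"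
        using w by (simp only: adj Q_mem quasinormal)
      then show ?thesis using w by (simp add: adj')
    qed
    have "0 \<le> Re (p (Q z - Q (Q w)) (Q z - Q (Q w)))"
      using z w by (simp add: s_nonneg)
    then have "0 \<le> Re (p (Q z) (Q z)) - 2 * Re (p ?u ?v) + Re (p ?v ?v)"
      using z w by (simp add: norm_sq_diff 1 2)
    then show ?thesis using u w by (simp add: norm_sq_diff)
  qed
  have bound: "Re (p ?u ?u) - hnorm p z * hnorm p (Q (residual ?u (n + n))) \<le> Re (p (Q z) (Q z))"
    for n
  proof -
    obtain w where w: "w \<in> D" "?u - residual ?u n = Q' (Q w)"
      using residual_eq[OF u] by blast
    then have r: "?u - Q' (Q w) = residual ?u n" by (metis diff_diff_eq2 add_diff_cancel_left')
    \<comment> \<open>All iterations move to the second argument, which doubles the index; then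
      \<open>?u = Q' z\<close> puts \<open>Q\<close> in front of the residual, and that quantity is
      known to tend to 0.\<close>
    have "p (residual ?u n) (residual ?u n) = p z (Q (residual ?u (n + n)))"
      using z by (simp add: residual_shift adj')
    then have "Re (p (residual ?u n) (residual ?u n))
        \<le> hnorm p z * hnorm p (Q (residual ?u (n + n)))"
      using cauchy_schwarz[of z "Q (residual ?u (n + n))"] z
        complex_Re_le_cmod[of "p z (Q (residual ?u (n + n)))"] by simp
    then show ?thesis using approx[OF w(1)] r by simp
  qed
  have "strict_mono (\<lambda>n::nat. n + n)" by (simp add: strict_mono_def)
  from LIMSEQ_subseq_LIMSEQ[OF residual_tendsto[OF u] this]
  have "(\<lambda>n. Re (p ?u ?u) - hnorm p z * hnorm p (Q (residual ?u (n + n))))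
      \<longlonglongrightarrow> Re (p ?u ?u) - hnorm p z * 0"
    by (intro tendsto_intros) (simp add: o_def)
  then show ?thesis using bound by (intro LIMSEQ_le_const2) auto
qed

text \<open>Passing to this form is the induction step for the kernel. Its adjoint relation is where
  quasinormality enters: it swaps \<open>Q' Q\<close> with \<open>Q\<close> between two uses of the
  adjoint.\<close>

lemma shifted: "quasinormal_contraction D (\<lambda>x y. p (Q x) (Q y)) Q Q'"
proof
  fix x y z c assume x: "x \<in> D" and y: "y \<in> D"
  show "p (Q (c *\<^sub>C x)) (Q y) = c * p (Q x) (Q y)"
    using x y by (simp add: linear_map_scale[OF Q] s_scale_left)
  show "p (Q y) (Q x) = cnj (p (Q x) (Q y))"
    using x y by (intro s_commute) simp_all
  show "p (Q (Q x)) (Q y) = p (Q x) (Q (Q' y))"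
  proof -
    have "p (Q (Q x)) (Q y) = p (Q' (Q (Q x))) y" using x y by (simp add: adj')
    also have "\<dots> = p (Q (Q' (Q x))) y" using x by (simp add: quasinormal)
    also have "\<dots> = p (Q x) (Q (Q' y))" using x y by (simp add: adj adj')
    finally show ?thesis .
  qed
  assume "z \<in> D"
  then show "p (Q (x + y)) (Q z) = p (Q x) (Q z) + p (Q y) (Q z)"
    using x y by (simp add: linear_map_add[OF Q] s_add_left)
qed (use subspace_D Q Q' in \<open>simp_all add: s_nonneg quasinormal contraction\<close>)

lemma adj_funpow:
  "\<lbrakk>x \<in> D; y \<in> D\<rbrakk> \<Longrightarrow> p ((Q ^^ n) x) y = p x ((Q' ^^ n) y)"
  by (induction n arbitrary: x y)
     (simp_all add: adj funpow_swap1 linear_map_mem[OF linear_map_funpow[OF Q]]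
       linear_map_mem[OF linear_map_funpow[OF Q']])

end

text \<open>
  Completing the square in the variable \<open>y 0\<close> reduces the kernel of order \<open>Suc n\<close> for the form \<open>p\<close>
  to the kernel of order \<open>n\<close> for the form \<open>p (Q _) (Q _)\<close>, up to the hyponormality defect.
\<close>

lemma quasinormal_kernel_lower_bound:
  assumes "quasinormal_contraction D p Q Q'" and "\<And>i. y i \<in> D"
  shows "Re (p (\<Sum>i<n. (Q' ^^ i) (y i)) (\<Sum>i<n. (Q' ^^ i) (y i)))
    \<le> Re (\<Sum>i<n. \<Sum>j<n. p ((Q ^^ i) (y j)) ((Q ^^ j) (y i)))"
  using assms
proof (induction n arbitrary: p y)
  case 0
  interpret quasinormal_contraction D p Q Q' by (rule 0)
  show ?case by simp
next
  case (Suc n)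
  interpret quasinormal_contraction D p Q Q' by (rule Suc.prems)
  have y [simp]: "y i \<in> D" for i by (rule Suc.prems)
  have pow [simp]: "x \<in> D \<Longrightarrow> (Q ^^ i) x \<in> D" "x \<in> D \<Longrightarrow> (Q' ^^ i) x \<in> D" for i x
    using linear_map_mem[OF linear_map_funpow[OF Q]] linear_map_mem[OF linear_map_funpow[OF Q']]
    by auto
  \<comment> \<open>The tail with one factor \<open>Q'\<close> removed: this is the vector that the
    induction hypothesis produces for the shifted form.\<close>
  define z where "z = (\<Sum>i<n. (Q' ^^ i) (y (Suc i)))"
  have z: "z \<in> D" unfolding z_def by (rule D_sum) simp
  have Q'z: "Q' z = (\<Sum>i<n. (Q' ^^ Suc i) (y (Suc i)))"
    unfolding z_def by (subst linear_map_sum[OF Q' subspace_D]) simp_all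
  have sum_eq: "(\<Sum>i<Suc n. (Q' ^^ i) (y i)) = y 0 + Q' z"
    by (simp add: sum.lessThan_Suc_shift Q'z del: sum.lessThan_Suc)
  have row: "(\<Sum>j<n. p ((Q ^^ 0) (y (Suc j))) ((Q ^^ Suc j) (y 0))) = p (Q' z) (y 0)"
  proof -
    have "p (Q' z) (y 0) = (\<Sum>j<n. p ((Q' ^^ Suc j) (y (Suc j))) (y 0))"
      unfolding Q'z by (rule s_sum_left) (simp_all del: funpow.simps)
    also have "\<dots> = (\<Sum>j<n. p (y (Suc j)) ((Q ^^ Suc j) (y 0)))"
    proof (rule sum.cong)
      fix j
      have "p (y 0) ((Q' ^^ Suc j) (y (Suc j))) = p ((Q ^^ Suc j) (y 0)) (y (Suc j))"
        by (simp only: adj_funpow y)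
      then have "cnj (p (y 0) ((Q' ^^ Suc j) (y (Suc j)))) = cnj (p ((Q ^^ Suc j) (y 0)) (y (Suc j)))"
        by simp
      then show "p ((Q' ^^ Suc j) (y (Suc j))) (y 0) = p (y (Suc j)) ((Q ^^ Suc j) (y 0))"
        by (simp only: s_commute[of "y 0" "(Q' ^^ Suc j) (y (Suc j))"]
            s_commute[of "(Q ^^ Suc j) (y 0)" "y (Suc j)"] pow y)
    qed simp
    finally show ?thesis by simp
  qed
  have col: "(\<Sum>i<n. p ((Q ^^ Suc i) (y 0)) ((Q ^^ 0) (y (Suc i)))) = p (y 0) (Q' z)"
  proof -
    have "p (y 0) (Q' z) = (\<Sum>i<n. p (y 0) ((Q' ^^ Suc i) (y (Suc i))))"
      unfolding Q'z by (rule s_sum_right) (simp_all del: funpow.simps)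
    then show ?thesis by (simp add: adj_funpow del: funpow.simps)
  qed
  let ?S = "\<Sum>i<n. \<Sum>j<n. p (Q ((Q ^^ i) (y (Suc j)))) (Q ((Q ^^ j) (y (Suc i))))"
  have S: "(\<Sum>i<Suc n. \<Sum>j<Suc n. p ((Q ^^ i) (y j)) ((Q ^^ j) (y i)))
      = p (y 0) (y 0) + p (Q' z) (y 0) + p (y 0) (Q' z) + ?S"
    unfolding row[symmetric] col[symmetric]
    by (simp add: sum.lessThan_Suc_shift sum.distrib del: sum.lessThan_Suc)
  \<comment> \<open>Here the explicit square in the induction hypothesis matters: hyponormality
    lowers it to the square of \<open>Q' z\<close>, exactly the term missing from the square of
    \<open>y 0 + Q' z\<close>.\<close>
  have "Re (p (Q z) (Q z)) \<le> Re ?S"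
    unfolding z_def using Suc.IH[OF shifted, of "\<lambda>i. y (Suc i)"] by simp
  with hyponormal[OF z] have "Re (p (Q' z) (Q' z)) \<le> Re ?S" by linarith
  then show ?case
    unfolding sum_eq S using z by (simp add: s_add_left s_add_right)
qed

corollary quasinormal_kernel_nonneg:
  assumes "quasinormal_contraction D p Q Q'" and "\<And>i. y i \<in> D"
  shows "0 \<le> Re (\<Sum>i<n. \<Sum>j<n. p ((Q ^^ i) (y j)) ((Q ^^ j) (y i)))"
proof -
  interpret quasinormal_contraction D p Q Q' by (rule assms)
  have "(\<Sum>i<n. (Q' ^^ i) (y i)) \<in> D"
    by (rule D_sum) (simp add: assms(2) linear_map_mem[OF linear_map_funpow[OF Q']])
  from s_nonneg[OF this] show ?thesis
    using quasinormal_kernel_lower_bound[OF assms, where n = n] by (rule order_trans)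
qed

section \<open>The asymptotic form of a contraction\<close>

locale linear_contraction = semi_inner_space H ip
  for H :: "'v::complex_vector set" and ip +
  fixes T :: "'v \<Rightarrow> 'v"
  assumes T: "linear_map H H T"
    and contraction: "x \<in> H \<Longrightarrow> Re (ip (T x) (T x)) \<le> Re (ip x x)"
begin

lemmas T_pow = linear_map_funpow[OF T]

lemma T_pow_mem [simp]: "x \<in> H \<Longrightarrow> (T ^^ n) x \<in> H"
  by (rule linear_map_mem[OF T_pow])

lemma T_mem [simp]: "x \<in> H \<Longrightarrow> T x \<in> H"
  by (rule linear_map_mem[OF T])

lemma contraction_pow: "x \<in> H \<Longrightarrow> Re (ip ((T ^^ n) x) ((T ^^ n) x)) \<le> Re (ip x x)"
proof (induction n)
  case (Suc n)
  then show ?case using contraction[of "(T ^^ n) x"] by simp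
qed simp

text \<open>For a bounded \<open>T\<close> on a Hilbert space this is the form of the asymptotic
  limit of \<open>T\<close>, the limit of the products of the n-th power of the adjoint with
  \<open>T^n\<close>.\<close>

definition asymp_form :: "'v \<Rightarrow> 'v \<Rightarrow> complex" where
  "asymp_form x y = lim (\<lambda>n. ip ((T ^^ n) x) ((T ^^ n) y))"

lemma asymp_form_tendsto:
  assumes x: "x \<in> H" and y: "y \<in> H"
  shows "(\<lambda>n. ip ((T ^^ n) x) ((T ^^ n) y)) \<longlonglongrightarrow> asymp_form x y"
proof -
  have diag: "convergent (\<lambda>n. ip ((T ^^ n) z) ((T ^^ n) z))" if z: "z \<in> H" for z
  proof -
    let ?a = "\<lambda>n. Re (ip ((T ^^ n) z) ((T ^^ n) z))"
    have "decseq ?a"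
      using z by (intro decseq_SucI) (simp add: contraction)
    moreover have "\<forall>n. 0 \<le> ?a n" using z by (simp add: s_nonneg)
    ultimately obtain l where "?a \<longlonglongrightarrow> l" by (rule decseq_convergent) blast
    then have "(\<lambda>n. complex_of_real (?a n)) \<longlonglongrightarrow> complex_of_real l" by (rule tendsto_of_real)
    moreover have "complex_of_real (?a n) = ip ((T ^^ n) z) ((T ^^ n) z)" for n
      using z by (simp add: complex_eq_iff s_Im_self)
    ultimately show ?thesis by (auto simp: convergent_def)
  qed
  have "convergent (\<lambda>n. ip ((T ^^ n) x) ((T ^^ n) y))"
  proof (rule convergent_polarization)
    fix c
    show "convergent (\<lambda>n. ip ((T ^^ n) x + c *\<^sub>C (T ^^ n) y) ((T ^^ n) x + c *\<^sub>C (T ^^ n) y))"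
      using diag[of "x + c *\<^sub>C y"] x y
      by (simp add: linear_map_add[OF T_pow] linear_map_scale[OF T_pow])
  qed (use x y in simp_all)
  then show ?thesis by (simp add: asymp_form_def convergent_LIMSEQ_iff)
qed

lemma asymp_form_unique:
  "\<lbrakk>x \<in> H; y \<in> H; (\<lambda>n. ip ((T ^^ n) x) ((T ^^ n) y)) \<longlonglongrightarrow> l\<rbrakk> \<Longrightarrow> asymp_form x y = l"
  by (rule LIMSEQ_unique[OF asymp_form_tendsto])

lemma asymp_form_semi_inner: "semi_inner_space H asymp_form"
proof
  fix x y z c assume x: "x \<in> H" and y: "y \<in> H"
  show "asymp_form (c *\<^sub>C x) y = c * asymp_form x y"
    using x y tendsto_mult_left[OF asymp_form_tendsto[OF x y], of c]
    by (intro asymp_form_unique) (simp_all add: linear_map_scale[OF T_pow] s_scale_left)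
  show "asymp_form y x = cnj (asymp_form x y)"
  proof (intro asymp_form_unique x y)
    have "(\<lambda>n. cnj (ip ((T ^^ n) x) ((T ^^ n) y))) \<longlonglongrightarrow> cnj (asymp_form x y)"
      using asymp_form_tendsto[OF x y] by (rule tendsto_cnj)
    moreover have "cnj (ip ((T ^^ n) x) ((T ^^ n) y)) = ip ((T ^^ n) y) ((T ^^ n) x)" for n
      using x y by (metis T_pow_mem s_commute)
    ultimately show "(\<lambda>n. ip ((T ^^ n) y) ((T ^^ n) x)) \<longlonglongrightarrow> cnj (asymp_form x y)" by simp
  qed
  show "0 \<le> Re (asymp_form x x)"
    using x
    by (intro LIMSEQ_le_const[OF tendsto_Re[OF asymp_form_tendsto[OF x x]]]) (simp add: s_nonneg)
  assume z: "z \<in> H"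
  show "asymp_form (x + y) z = asymp_form x z + asymp_form y z"
    using x y z tendsto_add[OF asymp_form_tendsto[OF x z] asymp_form_tendsto[OF y z]]
    by (intro asymp_form_unique) (simp_all add: linear_map_add[OF T_pow] s_add_left)
qed (rule subspace_D)

lemma asymp_form_le: "x \<in> H \<Longrightarrow> Re (asymp_form x x) \<le> Re (ip x x)"
  using tendsto_Re[OF asymp_form_tendsto[of x x]] contraction_pow
  by (intro LIMSEQ_le_const2[where X = "\<lambda>n. Re (ip ((T ^^ n) x) ((T ^^ n) x))"]) auto

text \<open>Applying \<open>T^k\<close> to both arguments drops the first \<open>k\<close> terms of
  the defining sequence.\<close>

lemma asymp_form_isometry:
  assumes x: "x \<in> H" and y: "y \<in> H"
  shows "asymp_form ((T ^^ k) x) ((T ^^ k) y) = asymp_form x y"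
  using x y LIMSEQ_ignore_initial_segment[OF asymp_form_tendsto[OF x y], of k]
  by (intro asymp_form_unique) (simp_all add: funpow_add)

text \<open>Since \<open>T\<close> is isometric for the asymptotic form, the kernel is the square of \<open>\<Sum>j. T ^ (2 n - j) (h j)\<close>.\<close>

lemma asymp_form_kernel_nonneg:
  assumes h: "\<And>i. h i \<in> H"
  shows "0 \<le> Re (\<Sum>i<n. \<Sum>j<n. asymp_form ((T ^^ i) (h j)) ((T ^^ j) (h i)))"
proof -
  interpret L: semi_inner_space H asymp_form by (rule asymp_form_semi_inner)
  define g where "g = (\<Sum>j<n. (T ^^ (2 * n - j)) (h j))"
  have g: "g \<in> H" unfolding g_def by (rule D_sum) (simp add: h)
  have row: "asymp_form w g = (\<Sum>i<n. asymp_form w ((T ^^ (2 * n - i)) (h i)))" if "w \<in> H" for w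
    unfolding g_def using that h by (intro L.s_sum_right) simp_all
  have "asymp_form g g = (\<Sum>j<n. asymp_form ((T ^^ (2 * n - j)) (h j)) g)"
    using L.s_sum_left[OF _ g, of "{..<n}" "\<lambda>j. (T ^^ (2 * n - j)) (h j)"] h by (simp flip: g_def)
  also have "\<dots> = (\<Sum>j<n. \<Sum>i<n. asymp_form ((T ^^ (2 * n - j)) (h j)) ((T ^^ (2 * n - i)) (h i)))"
    using h by (simp add: row)
  also have "\<dots> = (\<Sum>j<n. \<Sum>i<n. asymp_form ((T ^^ i) (h j)) ((T ^^ j) (h i)))"
  proof (intro sum.cong refl)
    fix i j assume "j \<in> {..<n}" "i \<in> {..<n}"
    \<comment> \<open>Both indices are below \<open>n\<close>, so the common exponent
      \<open>2 * n - i - j\<close> is not truncated; that power of \<open>T\<close> cancels by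
      isometry.\<close>
    then have "2 * n - j = (2 * n - i - j) + i" "2 * n - i = (2 * n - i - j) + j" by auto
    then have "asymp_form ((T ^^ (2 * n - j)) (h j)) ((T ^^ (2 * n - i)) (h i))
        = asymp_form ((T ^^ (2 * n - i - j)) ((T ^^ i) (h j))) ((T ^^ (2 * n - i - j)) ((T ^^ j) (h i)))"
      by (metis comp_apply funpow_add)
    then show "asymp_form ((T ^^ (2 * n - j)) (h j)) ((T ^^ (2 * n - i)) (h i))
        = asymp_form ((T ^^ i) (h j)) ((T ^^ j) (h i))"
      by (simp add: asymp_form_isometry h)
  qed
  also have "\<dots> = (\<Sum>i<n. \<Sum>j<n. asymp_form ((T ^^ i) (h j)) ((T ^^ j) (h i)))"
    by (rule sum.swap)
  finally show ?thesis using L.s_nonneg[OF g] by simp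
qed

definition defect_form :: "'v \<Rightarrow> 'v \<Rightarrow> complex" where
  "defect_form x y = ip x y - asymp_form x y"

lemma defect_form_semi_inner: "semi_inner_space H defect_form"
proof -
  interpret L: semi_inner_space H asymp_form by (rule asymp_form_semi_inner)
  show ?thesis
  proof
    show "defect_form y x = cnj (defect_form x y)" if "x \<in> H" "y \<in> H" for x y
      using that s_commute[of x y] L.s_commute[of x y] by (simp add: defect_form_def)
  qed (simp_all add: subspace_D defect_form_def s_add_left s_scale_left L.s_add_left L.s_scale_left
      algebra_simps asymp_form_le)
qed

text \<open>The asymptotic part is unchanged by \<open>T\<close>, so the whole loss of norm falls on
  the defect part.\<close>

lemma defect_form_contraction:
  "x \<in> H \<Longrightarrow> Re (defect_form (T x) (T x)) \<le> Re (defect_form x x)"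
  using asymp_form_isometry[of x x 1] contraction[of x] by (simp add: defect_form_def)

end

section \<open>The kernel of a contraction of class Q\<close>

theorem class_Q_kernel_nonneg:
  assumes H: "complex_hilbert_space H ip" and con: "linear_contraction H ip T"
    and cQ: "class_Q H ip T" and h: "\<And>i. h i \<in> H"
  shows "0 \<le> Re (\<Sum>i<n. \<Sum>j<n. ip ((T ^^ i) (h j)) ((T ^^ j) (h i)))"
proof -
  interpret linear_contraction H ip T by (rule con)
  interpret L: semi_inner_space H asymp_form by (rule asymp_form_semi_inner)
  interpret R: semi_inner_space H defect_form by (rule defect_form_semi_inner)
  from cQ obtain H1 H2 V E Q where
    dec: "orthogonal_decomposition H ip H1 H2"
    and V: "V \<in> bounded_operators H1 ip H1 ip"
    and E: "E \<in> bounded_operators H2 ip H1 ip"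
    and Q: "Q \<in> bounded_operators H2 ip H2 ip"
    and blocks: "\<And>x y. x \<in> H1 \<Longrightarrow> y \<in> H2 \<Longrightarrow> T (x + y) = (V x + E y) + Q y"
    and rel: "\<And>x. x \<in> H1 \<Longrightarrow> hadjoint H1 ip H1 ip V (V x) = x"
      "\<And>y. y \<in> H2 \<Longrightarrow> hadjoint H1 ip H1 ip V (E y) = 0"
      "\<And>y. y \<in> H2 \<Longrightarrow> Q (hadjoint H2 ip H1 ip E (E y)) = hadjoint H2 ip H1 ip E (E (Q y))"
    and quasi: "quasinormal_operator H2 ip Q"
    unfolding class_Q_def Let_def by blast
  have H1: "complex_hilbert_space H1 ip" and H2: "complex_hilbert_space H2 ip"
    and H_eq: "H = {x + y | x y. x \<in> H1 \<and> y \<in> H2}"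
    and orth: "\<And>x y. x \<in> H1 \<Longrightarrow> y \<in> H2 \<Longrightarrow> ip x y = 0"
    using dec unfolding orthogonal_decomposition_def by blast+
  interpret H1: complex_hilbert_space H1 ip by (rule H1)
  interpret H2: complex_hilbert_space H2 ip by (rule H2)
  have H1_sub: "x \<in> H" if "x \<in> H1" for x
    using H_eq that H2.D_zero by force
  have H2_sub: "y \<in> H" if "y \<in> H2" for y
    using H_eq that H1.D_zero by force
  define Q' where "Q' = hadjoint H2 ip H2 ip Q"
  note linV = bounded_operators_linear_map[OF V]
    and linE = bounded_operators_linear_map[OF E]
    and linQ = bounded_operators_linear_map[OF Q]
  have linQ': "linear_map H2 H2 Q'"
    unfolding Q'_def by (rule bounded_operators_linear_map[OF hadjoint_spec(1)[OF H2 H2 Q]])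
  note mem [simp] = linear_map_mem[OF linV] linear_map_mem[OF linE] linear_map_mem[OF linQ]
    linear_map_mem[OF linQ']
  have Q_adj: "ip (Q x) y = ip x (Q' y)" if "x \<in> H2" "y \<in> H2" for x y
    unfolding Q'_def using that by (rule hadjoint_spec[OF H2 H2 Q])
  have Q_quasi: "Q (Q' (Q x)) = Q' (Q (Q x))" if "x \<in> H2" for x
    using quasi that unfolding quasinormal_operator_def Q'_def Let_def by blast
  have VV: "ip (V x) (V x') = ip x x'" if "x \<in> H1" "x' \<in> H1" for x x'
    using that by (simp add: hadjoint_spec[OF H1 H1 V] rel)
  have VE: "ip (V x) (E y) = 0" if "x \<in> H1" "y \<in> H2" for x y
    using that by (simp add: hadjoint_spec[OF H1 H1 V] rel)
  \<comment> \<open>Commutation of \<open>Q\<close> with E'E, read as a statement on forms: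
    \<open>Q'\<close> is an adjoint of \<open>Q\<close> also for the form induced by
    \<open>E\<close>.\<close>
  have EE: "ip (E (Q y)) (E y') = ip (E y) (E (Q' y'))" if y: "y \<in> H2" and y': "y' \<in> H2" for y y'
  proof -
    let ?E' = "hadjoint H2 ip H1 ip E"
    have E': "?E' x \<in> H2" if "x \<in> H1" for x
      using that by (rule linear_map_mem[OF bounded_operators_linear_map[OF hadjoint_spec(1)[OF H2 H1 E]]])
    have flip: "ip (?E' (E v)) w = ip (E v) (E w)" if "v \<in> H2" "w \<in> H2" for v w
    proof -
      have "ip (E w) (E v) = ip w (?E' (E v))"
        using that by (simp add: hadjoint_spec(2)[OF H2 H1 E])
      then have "cnj (ip (E w) (E v)) = cnj (ip w (?E' (E v)))" by simp
      then show ?thesis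
        using that E' H1.s_commute[of "E w" "E v"] H2.s_commute[of w "?E' (E v)"] by simp
    qed
    have "ip (E (Q y)) (E y') = ip (Q (?E' (E y))) y'"
      using y y' by (simp add: rel(3) flip)
    also have "\<dots> = ip (E y) (E (Q' y'))"
      using y y' by (simp add: Q_adj E' flip)
    finally show ?thesis .
  qed
  have T1: "T x = V x" if "x \<in> H1" for x
    using blocks[OF that H2.D_zero] linear_map_zero[OF linE H2.subspace_D]
      linear_map_zero[OF linQ H2.subspace_D] by simp
  have T2: "T y = E y + Q y" if "y \<in> H2" for y
    using blocks[OF H1.D_zero that] linear_map_zero[OF linV H1.subspace_D] by simp
  have pow1: "(T ^^ k) x \<in> H1" if "x \<in> H1" for x k
    using that by (induction k) (simp_all add: T1)
  \<comment> \<open>The relations for the asymptotic form are proved at every finite stage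
    \<open>k\<close>, where the block structure allows induction.\<close>
  define f where "f k x y = ip ((T ^^ k) x) ((T ^^ k) y)" for k x y
  have f_add: "f k (x + y) (x' + y') = f k x x' + f k x y' + f k y x' + f k y y'"
    if "x \<in> H" "y \<in> H" "x' \<in> H" "y' \<in> H" for k x y x' y'
    using that by (simp add: f_def linear_map_add[OF T_pow] s_add_left s_add_right)
  have f_Suc: "f (Suc k) x y = f k (T x) (T y)" for k x y
    by (simp add: f_def funpow_swap1)
  have f_comm: "f k y x = cnj (f k x y)" if "x \<in> H" "y \<in> H" for k x y
    unfolding f_def using that by (intro s_commute) simp_all
  have f11: "f k x x' = ip x x'" if "x \<in> H1" "x' \<in> H1" for k x x'
    using that by (induction k arbitrary: x x') (simp add: f_def, simp add: f_Suc T1 VV)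
  \<comment> \<open>One application of \<open>T\<close> gives \<open>y\<close> the component
    \<open>E y\<close> in \<open>H1\<close>, but that is orthogonal to \<open>V x\<close>, so
    orthogonality survives every power.\<close>
  have f12: "f k x y = 0" if "x \<in> H1" "y \<in> H2" for k x y
    using that
  proof (induction k arbitrary: x y)
    case (Suc k)
    have "f k (V x + 0) (E y + Q y) = 0"
      using Suc f_add[of "V x" 0 "E y" "Q y" k]
      by (simp add: H1_sub H2_sub f11 VE)
    then show ?case using Suc by (simp add: f_Suc T1 T2)
  qed (simp add: f_def orth)
  have f22: "f (Suc k) y y' = ip (E y) (E y') + f k (Q y) (Q y')" if "y \<in> H2" "y' \<in> H2" for k y y'
    using that f_comm[of "E y'" "Q y" k]
    by (simp add: f_Suc T2 f_add H1_sub H2_sub f11 f12)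
  \<comment> \<open>By \<open>f22\<close> the form at \<open>Suc k\<close> is the form induced by
    \<open>E\<close> plus the form at \<open>k\<close> shifted by \<open>Q\<close>.
    \<open>EE\<close> settles the first part, and quasinormality the second by the computation of
    \<open>shifted\<close>.\<close>
  have f_adj: "f k (Q y) y' = f k y (Q' y')" if "y \<in> H2" "y' \<in> H2" for k y y'
    using that
  proof (induction k arbitrary: y y')
    case 0
    then show ?case by (simp add: f_def Q_adj)
  next
    case (Suc k)
    have flip: "f k (Q' v) w = f k v (Q w)" if "v \<in> H2" "w \<in> H2" for v w
      using Suc.IH[OF that(2,1)] f_comm[of "Q w" v k] f_comm[of w "Q' v" k] that
      by (simp add: H2_sub)
    have "f k (Q (Q y)) (Q y') = f k (Q' (Q (Q y))) y'"
      using Suc.prems by (simp add: flip)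
    also have "\<dots> = f k (Q' (Q y)) (Q' y')"
      using Suc.prems by (simp add: Suc.IH flip: Q_quasi)
    also have "\<dots> = f k (Q y) (Q (Q' y'))"
      using Suc.prems by (simp add: flip)
    finally show ?case
      using Suc.prems by (simp add: f22 EE)
  qed
  have L_adj: "asymp_form (Q y) y' = asymp_form y (Q' y')" if y: "y \<in> H2" and y': "y' \<in> H2" for y y'
    using asymp_form_tendsto[of y "Q' y'"] f_adj[OF y y'] y y'
    by (intro asymp_form_unique) (simp_all add: H2_sub f_def)
  \<comment> \<open>As \<open>V\<close> is isometric, the asymptotic norm of \<open>x\<close> is its
    norm; so \<open>x\<close> is a null vector of the defect form.\<close>
  have R1: "defect_form x z = 0" if x: "x \<in> H1" and z: "z \<in> H" for x z
  proof (rule R.s_null_left)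
    have "asymp_form x x = ip x x"
      using x f11[OF x x] by (intro asymp_form_unique) (simp_all add: H1_sub f_def)
    then show "Re (defect_form x x) = 0" by (simp add: defect_form_def)
  qed (simp_all add: x z H1_sub)
  have R2: "defect_form (x + y) (x' + y') = defect_form y y'"
    if "x \<in> H1" "x' \<in> H1" "y \<in> H" "y' \<in> H" for x y x' y'
    using that R1[of x "x' + y'"] R1[of x' y] R.s_commute[of x' y]
    by (simp add: H1_sub R.s_add_left R.s_add_right)
  have quasinormal: "quasinormal_contraction H2 defect_form Q Q'"
  proof -
    \<comment> \<open>\<open>T y\<close> and \<open>Q y\<close> differ by the null vector
      \<open>E y\<close>, so contractivity is inherited from \<open>T\<close>.\<close>
    have con: "Re (defect_form (Q y) (Q y)) \<le> Re (defect_form y y)" if y: "y \<in> H2" for y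
      using defect_form_contraction[of y] R2[of "E y" "E y" "Q y" "Q y"] y
      by (simp add: T2 H2_sub)
    show ?thesis
    proof (intro quasinormal_contraction.intro quasinormal_contraction_axioms.intro)
      show "semi_inner_space H2 defect_form"
        by (rule semi_inner_space_subspace[OF defect_form_semi_inner H2.subspace_D])
           (blast intro: H2_sub)
      show "defect_form (Q x) y = defect_form x (Q' y)" if "x \<in> H2" "y \<in> H2" for x y
        using that by (simp add: defect_form_def Q_adj L_adj)
    qed (fact linQ linQ' Q_quasi con)+
  qed
  have "\<exists>x y. x \<in> H1 \<and> y \<in> H2 \<and> h i = x + y" for i
    using h[of i] H_eq by blast
  then obtain h1 h2 where dec_h: "\<And>i. h1 i \<in> H1" "\<And>i. h2 i \<in> H2" "\<And>i. h i = h1 i + h2 i"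
    by metis
  have Q_pow: "(Q ^^ k) y \<in> H2" if "y \<in> H2" for k y
    using that by (rule linear_map_mem[OF linear_map_funpow[OF linQ]])
  \<comment> \<open>Modulo \<open>H1\<close>, which the defect form does not see, powers of
    \<open>T\<close> act on \<open>H2\<close> as powers of \<open>Q\<close>.\<close>
  have pow2: "\<exists>x\<in>H1. (T ^^ k) y = x + (Q ^^ k) y" if y: "y \<in> H2" for k y
  proof (induction k)
    case 0
    then show ?case by (metis H1.D_zero add_0 funpow_0)
  next
    case (Suc k)
    then obtain x where x: "x \<in> H1" "(T ^^ k) y = x + (Q ^^ k) y" by blast
    then have "(T ^^ Suc k) y = (V x + E ((Q ^^ k) y)) + (Q ^^ Suc k) y"
      using blocks[OF x(1) Q_pow[OF y]] by simp
    then show ?case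
      using x(1) Q_pow[OF y, of k] by (intro bexI[of _ "V x + E ((Q ^^ k) y)"]) simp_all
  qed
  have pow_dec: "\<exists>x\<in>H1. (T ^^ k) (h i) = x + (Q ^^ k) (h2 i)" for k i
  proof -
    obtain x where x: "x \<in> H1" "(T ^^ k) (h2 i) = x + (Q ^^ k) (h2 i)" using pow2 dec_h by blast
    then have "(T ^^ k) (h i) = ((T ^^ k) (h1 i) + x) + (Q ^^ k) (h2 i)"
      using dec_h by (simp add: linear_map_add[OF T_pow] H1_sub H2_sub add.assoc)
    then show ?thesis
      using pow1[OF dec_h(1)] x(1) by (intro bexI[of _ "(T ^^ k) (h1 i) + x"]) simp_all
  qed
  have R_eq: "defect_form ((T ^^ i) (h j)) ((T ^^ j) (h i))
      = defect_form ((Q ^^ i) (h2 j)) ((Q ^^ j) (h2 i))" for i j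
  proof -
    obtain x x' where "x \<in> H1" "(T ^^ i) (h j) = x + (Q ^^ i) (h2 j)"
      "x' \<in> H1" "(T ^^ j) (h i) = x' + (Q ^^ j) (h2 i)"
      using pow_dec[of i j] pow_dec[of j i] by blast
    then show ?thesis
      using R2[of x x'] Q_pow[OF dec_h(2)] by (simp add: H2_sub)
  qed
  have "ip x y = asymp_form x y + defect_form x y" for x y
    by (simp add: defect_form_def)
  then have "(\<Sum>i<n. \<Sum>j<n. ip ((T ^^ i) (h j)) ((T ^^ j) (h i)))
      = (\<Sum>i<n. \<Sum>j<n. asymp_form ((T ^^ i) (h j)) ((T ^^ j) (h i)))
      + (\<Sum>i<n. \<Sum>j<n. defect_form ((Q ^^ i) (h2 j)) ((Q ^^ j) (h2 i)))"
    by (simp add: sum.distrib R_eq)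
  then show ?thesis
    using asymp_form_kernel_nonneg[of h n, OF h]
      quasinormal_kernel_nonneg[OF quasinormal, of h2 n] dec_h by simp
qed

section \<open>Completion of a semi-inner product space\<close>

context semi_inner_space
begin

text \<open>Representatives only: sequences at distance 0 stay distinct here and are identified
  later by \<open>rep\<close>.\<close>

definition cauchy_seqs :: "(nat \<Rightarrow> 'd) set" where
  "cauchy_seqs = {\<sigma>. (\<forall>n. \<sigma> n \<in> D) \<and>
     (\<forall>e>0. \<exists>N. \<forall>m\<ge>N. \<forall>n\<ge>N. hnorm s (\<sigma> m - \<sigma> n) < e)}"

definition limit_form :: "(nat \<Rightarrow> 'd) \<Rightarrow> (nat \<Rightarrow> 'd) \<Rightarrow> complex" where
  "limit_form \<sigma> \<tau> = lim (\<lambda>n. s (\<sigma> n) (\<tau> n))"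

lemma cauchy_seqsI:
  "\<lbrakk>\<And>n. \<sigma> n \<in> D; \<And>e. 0 < e \<Longrightarrow> \<exists>N. \<forall>m\<ge>N. \<forall>n\<ge>N. hnorm s (\<sigma> m - \<sigma> n) < e\<rbrakk> \<Longrightarrow> \<sigma> \<in> cauchy_seqs"
  unfolding cauchy_seqs_def by blast

lemma cauchy_seqs_mem [simp]: "\<sigma> \<in> cauchy_seqs \<Longrightarrow> \<sigma> n \<in> D"
  by (simp add: cauchy_seqs_def)

lemma cauchy_seqsD:
  "\<sigma> \<in> cauchy_seqs \<Longrightarrow> 0 < e \<Longrightarrow> \<exists>N. \<forall>m\<ge>N. \<forall>n\<ge>N. hnorm s (\<sigma> m - \<sigma> n) < e"
  unfolding cauchy_seqs_def by blast

lemma cauchy_seqs_const [simp]: "d \<in> D \<Longrightarrow> (\<lambda>_. d) \<in> cauchy_seqs"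
  by (rule cauchy_seqsI) simp_all

lemma cauchy_seqs_image:
  assumes f: "linear_map D D f" and bound: "\<forall>x\<in>D. hnorm s (f x) \<le> C * hnorm s x"
    and \<sigma>: "\<sigma> \<in> cauchy_seqs"
  shows "f \<circ> \<sigma> \<in> cauchy_seqs"
proof (rule cauchy_seqsI)
  fix e :: real assume e: "0 < e"
  \<comment> \<open>A strictly positive constant above \<open>C\<close>, by which \<open>e\<close>
    can be divided.\<close>
  define C' where "C' = \<bar>C\<bar> + 1"
  have C': "0 < C'" "C \<le> C'" by (simp_all add: C'_def)
  obtain N where N: "\<And>m n. m \<ge> N \<Longrightarrow> n \<ge> N \<Longrightarrow> hnorm s (\<sigma> m - \<sigma> n) < e / C'"
    using cauchy_seqsD[OF \<sigma>, of "e / C'"] e C' by auto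
  have "hnorm s ((f \<circ> \<sigma>) m - (f \<circ> \<sigma>) n) < e" if "m \<ge> N" "n \<ge> N" for m n
  proof -
    have "hnorm s ((f \<circ> \<sigma>) m - (f \<circ> \<sigma>) n) = hnorm s (f (\<sigma> m - \<sigma> n))"
      using \<sigma> by (simp add: linear_map_diff[OF f subspace_D])
    also have "\<dots> \<le> C * hnorm s (\<sigma> m - \<sigma> n)" using \<sigma> by (simp add: bound)
    also have "\<dots> \<le> C' * hnorm s (\<sigma> m - \<sigma> n)"
      using \<sigma> C' by (intro mult_right_mono) (simp_all add: hnorm_nonneg)
    also have "\<dots> < C' * (e / C')" using N[OF that] C'(1) by (rule mult_strict_left_mono)
    finally show ?thesis using C' by simp
  qed
  then show "\<exists>N. \<forall>m\<ge>N. \<forall>n\<ge>N. hnorm s ((f \<circ> \<sigma>) m - (f \<circ> \<sigma>) n) < e" by blast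
qed (use \<sigma> linear_map_mem[OF f] in simp)

lemma subspace_cauchy_seqs: "complex_vector.subspace cauchy_seqs"
  unfolding complex_vector.subspace_def
proof (intro conjI ballI allI)
  show "0 \<in> cauchy_seqs" using cauchy_seqs_const[OF D_zero] by (simp add: zero_fun_def)
next
  fix \<sigma> \<tau> assume \<sigma>: "\<sigma> \<in> cauchy_seqs" and \<tau>: "\<tau> \<in> cauchy_seqs"
  show "\<sigma> + \<tau> \<in> cauchy_seqs"
  proof (rule cauchy_seqsI)
    fix e :: real assume "0 < e"
    then have e2: "0 < e / 2" by simp
    obtain M where M: "\<And>m n. m \<ge> M \<Longrightarrow> n \<ge> M \<Longrightarrow> hnorm s (\<sigma> m - \<sigma> n) < e / 2"
      using cauchy_seqsD[OF \<sigma> e2] by blast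
    obtain N where N: "\<And>m n. m \<ge> N \<Longrightarrow> n \<ge> N \<Longrightarrow> hnorm s (\<tau> m - \<tau> n) < e / 2"
      using cauchy_seqsD[OF \<tau> e2] by blast
    have "hnorm s ((\<sigma> + \<tau>) m - (\<sigma> + \<tau>) n) < e" if "m \<ge> max M N" "n \<ge> max M N" for m n
    proof -
      have eq: "(\<sigma> + \<tau>) m - (\<sigma> + \<tau>) n = (\<sigma> m - \<sigma> n) + (\<tau> m - \<tau> n)" by simp
      have "hnorm s ((\<sigma> + \<tau>) m - (\<sigma> + \<tau>) n) \<le> hnorm s (\<sigma> m - \<sigma> n) + hnorm s (\<tau> m - \<tau> n)"
        unfolding eq using \<sigma> \<tau> by (intro hnorm_triangle) simp_all
      then show ?thesis using M[of m n] N[of m n] that by simp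
    qed
    then show "\<exists>N. \<forall>m\<ge>N. \<forall>n\<ge>N. hnorm s ((\<sigma> + \<tau>) m - (\<sigma> + \<tau>) n) < e" by blast
  qed (use \<sigma> \<tau> in simp)
next
  fix c \<sigma> assume \<sigma>: "\<sigma> \<in> cauchy_seqs"
  have "linear_map D D ((*\<^sub>C) c)"
    by (simp add: linear_map_def scaleC_add_right scaleC_scaleC mult.commute)
  from cauchy_seqs_image[OF this _ \<sigma>, of "cmod c"] show "c *\<^sub>C \<sigma> \<in> cauchy_seqs"
    by (simp add: hnorm_scale scaleC_fun_def o_def)
qed

lemma limit_form_tendsto:
  assumes \<sigma>: "\<sigma> \<in> cauchy_seqs" and \<tau>: "\<tau> \<in> cauchy_seqs"
  shows "(\<lambda>n. s (\<sigma> n) (\<tau> n)) \<longlonglongrightarrow> limit_form \<sigma> \<tau>"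
proof -
  have diag: "convergent (\<lambda>n. s (\<rho> n) (\<rho> n))" if \<rho>: "\<rho> \<in> cauchy_seqs" for \<rho>
  proof -
    have "Cauchy (\<lambda>n. hnorm s (\<rho> n))"
      unfolding Cauchy_def dist_real_def
      using cauchy_seqsD[OF \<rho>] hnorm_diff_le \<rho> by (meson cauchy_seqs_mem le_less_trans)
    then obtain l where "(\<lambda>n. hnorm s (\<rho> n)) \<longlonglongrightarrow> l"
      using Cauchy_convergent convergent_def by blast
    then have "(\<lambda>n. complex_of_real ((hnorm s (\<rho> n))\<^sup>2)) \<longlonglongrightarrow> of_real (l\<^sup>2)"
      by (intro tendsto_intros)
    moreover have "(\<lambda>n. s (\<rho> n) (\<rho> n)) = (\<lambda>n. complex_of_real ((hnorm s (\<rho> n))\<^sup>2))"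
      using \<rho> by (simp only: s_self cauchy_seqs_mem)
    ultimately show ?thesis by (simp only: convergentI)
  qed
  have "convergent (\<lambda>n. s (\<sigma> n) (\<tau> n))"
  proof (rule convergent_polarization)
    fix c
    have "\<sigma> + c *\<^sub>C \<tau> \<in> cauchy_seqs"
      using subspace_cauchy_seqs \<sigma> \<tau>
      by (intro complex_vector.subspace_add complex_vector.subspace_scale) auto
    from diag[OF this]
    show "convergent (\<lambda>n. s (\<sigma> n + c *\<^sub>C \<tau> n) (\<sigma> n + c *\<^sub>C \<tau> n))"
      by (simp add: scaleC_fun_def)
  qed (use \<sigma> \<tau> in simp_all)
  then show ?thesis by (simp add: limit_form_def convergent_LIMSEQ_iff)
qed

lemma limit_form_unique:
  "\<lbrakk>\<sigma> \<in> cauchy_seqs; \<tau> \<in> cauchy_seqs; (\<lambda>n. s (\<sigma> n) (\<tau> n)) \<longlonglongrightarrow> l\<rbrakk> \<Longrightarrow> limit_form \<sigma> \<tau> = l"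
  by (rule LIMSEQ_unique[OF limit_form_tendsto])

lemma limit_form_const [simp]: "d \<in> D \<Longrightarrow> e \<in> D \<Longrightarrow> limit_form (\<lambda>_. d) (\<lambda>_. e) = s d e"
  by (rule limit_form_unique) simp_all

lemma limit_form_semi_inner: "semi_inner_space cauchy_seqs limit_form"
proof
  fix x y z c assume x: "x \<in> cauchy_seqs" and y: "y \<in> cauchy_seqs"
  note sub = complex_vector.subspace_add[OF subspace_cauchy_seqs]
    complex_vector.subspace_scale[OF subspace_cauchy_seqs]
  show "limit_form (c *\<^sub>C x) y = c * limit_form x y"
    using x y tendsto_mult_left[OF limit_form_tendsto[OF x y], of c]
    by (intro limit_form_unique sub) (simp_all add: scaleC_fun_def s_scale_left)
  show "limit_form y x = cnj (limit_form x y)"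
  proof (intro limit_form_unique x y)
    have "(\<lambda>n. cnj (s (x n) (y n))) \<longlonglongrightarrow> cnj (limit_form x y)"
      using limit_form_tendsto[OF x y] by (rule tendsto_cnj)
    moreover have "cnj (s (x n) (y n)) = s (y n) (x n)" for n
      using x y by (metis cauchy_seqs_mem s_commute)
    ultimately show "(\<lambda>n. s (y n) (x n)) \<longlonglongrightarrow> cnj (limit_form x y)" by simp
  qed
  show "0 \<le> Re (limit_form x x)"
    using x
    by (intro LIMSEQ_le_const[OF tendsto_Re[OF limit_form_tendsto[OF x x]]]) (simp add: s_nonneg)
  assume z: "z \<in> cauchy_seqs"
  show "limit_form (x + y) z = limit_form x z + limit_form y z"
    using x y z tendsto_add[OF limit_form_tendsto[OF x z] limit_form_tendsto[OF y z]]
    by (intro limit_form_unique sub) (simp_all add: s_add_left)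
qed (rule subspace_cauchy_seqs)

lemma limit_norm_le:
  assumes \<sigma>: "\<sigma> \<in> cauchy_seqs" and e: "0 \<le> e" and le: "\<And>n. n \<ge> N \<Longrightarrow> hnorm s (\<sigma> n) \<le> e"
  shows "hnorm limit_form \<sigma> \<le> e"
proof -
  have "Re (limit_form \<sigma> \<sigma>) \<le> e\<^sup>2"
  proof (rule LIMSEQ_le_const2[OF tendsto_Re[OF limit_form_tendsto[OF \<sigma> \<sigma>]]])
    have "Re (s (\<sigma> n) (\<sigma> n)) \<le> e\<^sup>2" if "n \<ge> N" for n
      using power_mono[OF le[OF that], of 2] \<sigma> by (simp add: hnorm_nonneg hnorm_sq)
    then show "\<exists>N. \<forall>n\<ge>N. Re (s (\<sigma> n) (\<sigma> n)) \<le> e\<^sup>2" by blast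
  qed
  then show ?thesis using e by (simp add: hnorm_def real_le_lsqrt)
qed

end

text \<open>
  A vector of the completion is encoded by its inner products with a total family \<open>g\<close> in \<open>D\<close>, so that
  the completion is a space of functions on the index set of the family.
\<close>

locale generated_semi_inner_space = semi_inner_space D s
  for D :: "'d::complex_vector set" and s +
  fixes g :: "'i \<Rightarrow> 'j \<Rightarrow> 'd"
  assumes g_mem [simp]: "g i j \<in> D"
    and g_total: "D \<subseteq> complex_vector.span (\<Union>i. range (g i))"
begin

sublocale L: semi_inner_space cauchy_seqs limit_form
  by (rule limit_form_semi_inner)

definition rep :: "(nat \<Rightarrow> 'd) \<Rightarrow> 'i \<Rightarrow> 'j \<Rightarrow> complex" where
  "rep \<sigma> = (\<lambda>i j. limit_form \<sigma> (\<lambda>_. g i j))"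

definition completion_space :: "('i \<Rightarrow> 'j \<Rightarrow> complex) set" where
  "completion_space = rep ` cauchy_seqs"

definition seq_of :: "('i \<Rightarrow> 'j \<Rightarrow> complex) \<Rightarrow> nat \<Rightarrow> 'd" where
  "seq_of f = (SOME \<sigma>. \<sigma> \<in> cauchy_seqs \<and> rep \<sigma> = f)"

text \<open>\<open>seq_of\<close> picks an arbitrary representative;
  \<open>completion_form_rep\<close> shows independence of the pick.\<close>

definition completion_form :: "('i \<Rightarrow> 'j \<Rightarrow> complex) \<Rightarrow> ('i \<Rightarrow> 'j \<Rightarrow> complex) \<Rightarrow> complex" where
  "completion_form f f' = limit_form (seq_of f) (seq_of f')"

lemma seq_of:
  assumes "f \<in> completion_space"
  shows "seq_of f \<in> cauchy_seqs" and "rep (seq_of f) = f"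
proof -
  have "\<exists>\<sigma>. \<sigma> \<in> cauchy_seqs \<and> rep \<sigma> = f" using assms by (auto simp: completion_space_def)
  then have "seq_of f \<in> cauchy_seqs \<and> rep (seq_of f) = f"
    unfolding seq_of_def by (rule someI_ex)
  then show "seq_of f \<in> cauchy_seqs" and "rep (seq_of f) = f" by simp_all
qed

lemma rep_mem: "\<sigma> \<in> cauchy_seqs \<Longrightarrow> rep \<sigma> \<in> completion_space"
  by (simp add: completion_space_def)

lemma rep_add: "\<lbrakk>\<sigma> \<in> cauchy_seqs; \<tau> \<in> cauchy_seqs\<rbrakk> \<Longrightarrow> rep (\<sigma> + \<tau>) = rep \<sigma> + rep \<tau>"
  by (simp add: rep_def fun_eq_iff L.s_add_left)

lemma rep_diff: "\<lbrakk>\<sigma> \<in> cauchy_seqs; \<tau> \<in> cauchy_seqs\<rbrakk> \<Longrightarrow> rep (\<sigma> - \<tau>) = rep \<sigma> - rep \<tau>"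
  by (simp add: rep_def fun_eq_iff L.s_diff_left)

lemma rep_scale: "\<sigma> \<in> cauchy_seqs \<Longrightarrow> rep (c *\<^sub>C \<sigma>) = c *\<^sub>C rep \<sigma>"
  by (simp add: rep_def fun_eq_iff L.s_scale_left)
     (simp add: scaleC_fun_def scaleC_complex_def)

lemma rep_zero: "rep 0 = 0"
  by (simp add: rep_def fun_eq_iff)

text \<open>The kernel of \<open>rep\<close> is exactly the null space of \<open>limit_form\<close>.
  Totality of \<open>g\<close> turns vanishing on the family into orthogonality to all constant
  sequences, and these approximate \<open>\<sigma>\<close> itself.\<close>

lemma rep_eq_zero_iff:
  assumes \<sigma>: "\<sigma> \<in> cauchy_seqs"
  shows "rep \<sigma> = 0 \<longleftrightarrow> Re (limit_form \<sigma> \<sigma>) = 0"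
proof
  assume "Re (limit_form \<sigma> \<sigma>) = 0"
  then show "rep \<sigma> = 0"
    using \<sigma> by (simp add: rep_def fun_eq_iff L.s_null_left)
next
  assume rep: "rep \<sigma> = 0"
  have gen: "limit_form \<sigma> (\<lambda>_. d) = 0" if "d \<in> D" for d
  proof -
    let ?S = "{d \<in> D. limit_form \<sigma> (\<lambda>_. d) = 0}"
    have const_add: "(\<lambda>_. d + e) = (\<lambda>_. d) + (\<lambda>_. e)" for d e :: 'd by (simp add: fun_eq_iff)
    have const_scale: "(\<lambda>_. c *\<^sub>C d) = c *\<^sub>C (\<lambda>_. d)" for c and d :: 'd
      by (simp add: scaleC_fun_def)
    have const_zero: "(\<lambda>_. 0) = (0 :: nat \<Rightarrow> 'd)" by (simp add: fun_eq_iff)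
    have "complex_vector.subspace ?S"
      using \<sigma>
      by (auto simp: complex_vector.subspace_def const_add const_scale const_zero
          L.s_add_right L.s_scale_right)
    moreover have "(\<Union>i. range (g i)) \<subseteq> ?S"
      using rep by (auto simp: rep_def fun_eq_iff)
    ultimately have "complex_vector.span (\<Union>i. range (g i)) \<subseteq> ?S"
      by (simp add: complex_vector.span_minimal)
    then show ?thesis using g_total that by blast
  qed
  have "hnorm limit_form \<sigma> \<le> e" if e: "0 < e" for e
  proof -
    obtain N where N: "\<And>m n. m \<ge> N \<Longrightarrow> n \<ge> N \<Longrightarrow> hnorm s (\<sigma> m - \<sigma> n) < e"
      using cauchy_seqsD[OF \<sigma> e] by auto
    have "hnorm s (\<sigma> n) \<le> e" if n: "n \<ge> N" for n
    proof -
      let ?c = "\<lambda>_::nat. \<sigma> n"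
      have c: "?c \<in> cauchy_seqs" using \<sigma> by simp
      \<comment> \<open>Pythagoras: \<open>\<sigma>\<close> is orthogonal to the constant
        \<open>\<sigma> n\<close>, so the constant is no longer than the difference, which is small
        for large \<open>n\<close>.\<close>
      have "Re (s (\<sigma> n) (\<sigma> n)) \<le> Re (limit_form \<sigma> \<sigma>) - 2 * Re (limit_form \<sigma> ?c) + Re (s (\<sigma> n) (\<sigma> n))"
        using \<sigma> gen[of "\<sigma> n"] L.s_nonneg[OF \<sigma>] by simp
      also have "\<dots> = Re (limit_form (\<sigma> - ?c) (\<sigma> - ?c))"
        using \<sigma> c by (simp add: L.norm_sq_diff)
      finally have "hnorm s (\<sigma> n) \<le> hnorm limit_form (\<sigma> - ?c)"
        by (simp add: hnorm_def)
      also have "\<dots> \<le> e"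
        using \<sigma> c e N n by (intro limit_norm_le[where N = N] L.D_diff) (auto intro: less_imp_le)
      finally show ?thesis .
    qed
    then show ?thesis using \<sigma> e by (intro limit_norm_le[where N = N]) auto
  qed
  then have "hnorm limit_form \<sigma> \<le> 0" using field_le_epsilon[of "hnorm limit_form \<sigma>" 0] by simp
  then have "hnorm limit_form \<sigma> = 0" using L.hnorm_nonneg[OF \<sigma>] by simp
  then show "Re (limit_form \<sigma> \<sigma>) = 0" by (simp add: hnorm_def)
qed

lemma limit_form_cong:
  assumes "\<sigma> \<in> cauchy_seqs" "\<sigma>' \<in> cauchy_seqs" "\<tau> \<in> cauchy_seqs" "rep \<sigma> = rep \<sigma>'"
  shows "limit_form \<sigma> \<tau> = limit_form \<sigma>' \<tau>"
proof -
  have "rep (\<sigma> - \<sigma>') = 0" using assms by (simp add: rep_diff)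
  then have "limit_form (\<sigma> - \<sigma>') \<tau> = 0"
    using assms by (intro L.s_null_left) (simp_all add: rep_eq_zero_iff)
  then show ?thesis using assms by (simp add: L.s_diff_left)
qed

lemma completion_form_rep:
  assumes \<sigma>: "\<sigma> \<in> cauchy_seqs" and \<tau>: "\<tau> \<in> cauchy_seqs"
  shows "completion_form (rep \<sigma>) (rep \<tau>) = limit_form \<sigma> \<tau>"
proof -
  let ?\<sigma> = "seq_of (rep \<sigma>)" and ?\<tau> = "seq_of (rep \<tau>)"
  have m: "?\<sigma> \<in> cauchy_seqs" "?\<tau> \<in> cauchy_seqs" "rep ?\<sigma> = rep \<sigma>" "rep ?\<tau> = rep \<tau>"
    using \<sigma> \<tau> by (auto intro: seq_of rep_mem)
  have "limit_form ?\<sigma> ?\<tau> = limit_form \<sigma> ?\<tau>"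
    by (rule limit_form_cong[OF m(1) \<sigma> m(2,3)])
  also have "\<dots> = cnj (limit_form ?\<tau> \<sigma>)" by (rule L.s_commute[OF m(2) \<sigma>])
  also have "\<dots> = cnj (limit_form \<tau> \<sigma>)" by (simp only: limit_form_cong[OF m(2) \<tau> \<sigma> m(4)])
  also have "\<dots> = limit_form \<sigma> \<tau>" by (rule L.s_commute[OF \<tau> \<sigma>, symmetric])
  finally show ?thesis by (simp add: completion_form_def)
qed

lemma hnorm_rep: "\<sigma> \<in> cauchy_seqs \<Longrightarrow> hnorm completion_form (rep \<sigma>) = hnorm limit_form \<sigma>"
  by (simp add: hnorm_def completion_form_rep)

lemma completionE:
  assumes "f \<in> completion_space"
  obtains \<sigma> where "\<sigma> \<in> cauchy_seqs" "f = rep \<sigma>"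
  using assms by (auto simp: completion_space_def)

lemma const_dense:
  assumes \<sigma>: "\<sigma> \<in> cauchy_seqs" and e: "0 < e"
  shows "\<exists>d\<in>D. hnorm limit_form (\<sigma> - (\<lambda>_. d)) \<le> e"
proof -
  obtain N where N: "\<And>m n. m \<ge> N \<Longrightarrow> n \<ge> N \<Longrightarrow> hnorm s (\<sigma> m - \<sigma> n) < e"
    using cauchy_seqsD[OF \<sigma> e] by auto
  have "hnorm limit_form (\<sigma> - (\<lambda>_. \<sigma> N)) \<le> e"
    using \<sigma> e N by (intro limit_norm_le[where N = N] L.D_diff) (auto intro: less_imp_le)
  then show ?thesis using \<sigma> by (intro bexI[of _ "\<sigma> N"]) simp_all
qed

text \<open>Replace each \<open>S m\<close> by a constant sequence \<open>d m\<close> within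
  1/(m+1); the sequence \<open>d\<close> is then Cauchy in \<open>D\<close> and is itself the
  limit.\<close>

lemma limit_form_complete:
  assumes S: "\<And>m. S m \<in> cauchy_seqs"
    and cauchy: "\<And>e. 0 < e \<Longrightarrow> \<exists>N. \<forall>m\<ge>N. \<forall>n\<ge>N. hnorm limit_form (S m - S n) < e"
  shows "\<exists>d\<in>cauchy_seqs. (\<lambda>m. hnorm limit_form (S m - d)) \<longlonglongrightarrow> 0"
proof -
  have "\<exists>d\<in>D. hnorm limit_form (S m - (\<lambda>_. d)) \<le> 1 / real (Suc m)" for m
    by (rule const_dense) (simp_all add: S)
  then obtain d where d: "\<And>m. d m \<in> D"
    and close: "\<And>m. hnorm limit_form (S m - (\<lambda>_. d m)) \<le> 1 / real (Suc m)"
    by metis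
  have cd: "(\<lambda>_. d m) \<in> cauchy_seqs" for m using d by simp
  have close_e: "\<exists>N. \<forall>m\<ge>N. hnorm limit_form (S m - (\<lambda>_. d m)) < e" if e: "0 < e" for e
  proof -
    obtain N where N: "1 / real (Suc N) < e" using nat_approx_posE[OF e] by blast
    have "hnorm limit_form (S m - (\<lambda>_. d m)) < e" if "m \<ge> N" for m
    proof -
      have "1 / real (Suc m) \<le> 1 / real (Suc N)" using that by (intro divide_left_mono) auto
      then show ?thesis using close[of m] N by linarith
    qed
    then show ?thesis by blast
  qed
  have d_norm: "hnorm s (d m - d n) = hnorm limit_form ((\<lambda>_. d m) - (\<lambda>_. d n))" for m n
  proof -
    have "(\<lambda>_. d m) - (\<lambda>_. d n) = (\<lambda>_::nat. d m - d n)" by (simp add: fun_eq_iff)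
    then show ?thesis using d by (simp add: hnorm_def)
  qed
  have d_cauchy: "d \<in> cauchy_seqs"
  proof (rule cauchy_seqsI)
    fix e :: real assume e: "0 < e"
    obtain M where M: "\<And>m. m \<ge> M \<Longrightarrow> hnorm limit_form (S m - (\<lambda>_. d m)) < e / 3"
      using close_e[of "e / 3"] e by auto
    obtain N where N: "\<And>m n. m \<ge> N \<Longrightarrow> n \<ge> N \<Longrightarrow> hnorm limit_form (S m - S n) < e / 3"
      using cauchy[of "e / 3"] e by auto
    have "hnorm s (d m - d n) < e" if "m \<ge> max M N" "n \<ge> max M N" for m n
    proof -
      have "hnorm limit_form ((\<lambda>_. d m) - (\<lambda>_. d n))
          \<le> hnorm limit_form ((\<lambda>_. d m) - S m) + hnorm limit_form (S m - (\<lambda>_. d n))"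
        by (rule L.hnorm_triangle_diff[OF cd S cd])
      moreover have "hnorm limit_form (S m - (\<lambda>_. d n))
          \<le> hnorm limit_form (S m - S n) + hnorm limit_form (S n - (\<lambda>_. d n))"
        by (rule L.hnorm_triangle_diff[OF S S cd])
      moreover have "hnorm limit_form ((\<lambda>_. d m) - S m) = hnorm limit_form (S m - (\<lambda>_. d m))"
        by (rule L.hnorm_minus_commute[OF cd S])
      moreover have "m \<ge> M" "n \<ge> M" "m \<ge> N" "n \<ge> N" using that by auto
      ultimately show ?thesis
        using M[of m] M[of n] N[of m n] unfolding d_norm by linarith
    qed
    then show "\<exists>N. \<forall>m\<ge>N. \<forall>n\<ge>N. hnorm s (d m - d n) < e" by blast
  qed (rule d)
  have "(\<lambda>m. hnorm limit_form (S m - d)) \<longlonglongrightarrow> 0"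
  proof (rule LIMSEQ_I)
    fix e :: real assume e: "0 < e"
    obtain M where M: "\<And>m. m \<ge> M \<Longrightarrow> hnorm limit_form (S m - (\<lambda>_. d m)) < e / 2"
      using close_e[of "e / 2"] e by auto
    obtain N where N: "\<And>m n. m \<ge> N \<Longrightarrow> n \<ge> N \<Longrightarrow> hnorm s (d m - d n) < e / 2"
      using cauchy_seqsD[OF d_cauchy, of "e / 2"] e by auto
    have "norm (hnorm limit_form (S m - d) - 0) < e" if "m \<ge> max M N" for m
    proof -
      have "hnorm limit_form ((\<lambda>_. d m) - d) \<le> e / 2"
        using cd d_cauchy e N that
        by (intro limit_norm_le[where N = N] L.D_diff) (auto intro: less_imp_le)
      moreover have "hnorm limit_form (S m - d)
          \<le> hnorm limit_form (S m - (\<lambda>_. d m)) + hnorm limit_form ((\<lambda>_. d m) - d)"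
        by (rule L.hnorm_triangle_diff[OF S cd d_cauchy])
      moreover have "0 \<le> hnorm limit_form (S m - d)"
        by (intro L.hnorm_nonneg L.D_diff S d_cauchy)
      moreover have "m \<ge> M" using that by simp
      ultimately show ?thesis using M[of m] by simp
    qed
    then show "\<exists>N. \<forall>m\<ge>N. norm (hnorm limit_form (S m - d) - 0) < e" by blast
  qed
  then show ?thesis using d_cauchy by blast
qed

theorem completion_hilbert: "complex_hilbert_space completion_space completion_form"
proof
  show "complex_vector.subspace completion_space"
    unfolding complex_vector.subspace_def
  proof (intro conjI ballI allI)
    show "0 \<in> completion_space" using rep_mem[OF L.D_zero] by (simp add: rep_zero)
    show "x + y \<in> completion_space" if "x \<in> completion_space" "y \<in> completion_space" for x y
      using that by (elim completionE) (simp add: rep_mem flip: rep_add)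
    show "c *\<^sub>C x \<in> completion_space" if "x \<in> completion_space" for c x
      using that by (elim completionE) (simp add: rep_mem flip: rep_scale)
  qed
next
  fix x y z assume "x \<in> completion_space" "y \<in> completion_space" "z \<in> completion_space"
  then show "completion_form (x + y) z = completion_form x z + completion_form y z"
    by (elim completionE) (simp add: completion_form_rep L.s_add_left flip: rep_add)
next
  fix c x y assume "x \<in> completion_space" "y \<in> completion_space"
  then show "completion_form (c *\<^sub>C x) y = c * completion_form x y"
    by (elim completionE) (simp add: completion_form_rep L.s_scale_left flip: rep_scale)
next
  fix x y assume "x \<in> completion_space" "y \<in> completion_space"
  then obtain \<sigma> \<tau> where "\<sigma> \<in> cauchy_seqs" "x = rep \<sigma>" "\<tau> \<in> cauchy_seqs" "y = rep \<tau>"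
    unfolding completion_space_def by blast
  then show "completion_form y x = cnj (completion_form x y)"
    using L.s_commute[of \<sigma> \<tau>] by (simp add: completion_form_rep)
next
  fix x assume "x \<in> completion_space" "x \<noteq> 0"
  then obtain \<sigma> where \<sigma>: "\<sigma> \<in> cauchy_seqs" "x = rep \<sigma>" "rep \<sigma> \<noteq> 0"
    by (auto elim: completionE)
  then show "0 < Re (completion_form x x)"
    using L.s_nonneg[of \<sigma>] by (simp add: completion_form_rep rep_eq_zero_iff)
next
  fix F :: "nat \<Rightarrow> 'i \<Rightarrow> 'j \<Rightarrow> complex"
  assume F: "\<And>n. F n \<in> completion_space"
    and cauchy: "\<And>e. 0 < e \<Longrightarrow> \<exists>N. \<forall>m\<ge>N. \<forall>n\<ge>N. hnorm completion_form (F m - F n) < e"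
  define S where "S n = seq_of (F n)" for n
  have S: "S n \<in> cauchy_seqs" "F n = rep (S n)" for n
    using seq_of[OF F] by (simp_all add: S_def)
  have "\<exists>d\<in>cauchy_seqs. (\<lambda>m. hnorm limit_form (S m - d)) \<longlonglongrightarrow> 0"
  proof (rule limit_form_complete)
    show "\<exists>N. \<forall>m\<ge>N. \<forall>n\<ge>N. hnorm limit_form (S m - S n) < e" if "0 < e" for e
      using cauchy[OF that] S(1) by (simp add: S(2) hnorm_rep flip: rep_diff)
  qed (rule S)
  then obtain d where d: "d \<in> cauchy_seqs" "(\<lambda>m. hnorm limit_form (S m - d)) \<longlonglongrightarrow> 0" by blast
  then have "(\<lambda>m. hnorm completion_form (F m - rep d)) \<longlonglongrightarrow> 0"
    using S(1) by (simp add: S(2) hnorm_rep flip: rep_diff)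
  then show "\<exists>x\<in>completion_space. (\<lambda>n. hnorm completion_form (F n - x)) \<longlonglongrightarrow> 0"
    using rep_mem[OF d(1)] by blast
qed

section \<open>Extension of bounded operators to the completion\<close>

definition lift :: "('d \<Rightarrow> 'd) \<Rightarrow> ('i \<Rightarrow> 'j \<Rightarrow> complex) \<Rightarrow> 'i \<Rightarrow> 'j \<Rightarrow> complex" where
  "lift A f = rep (A \<circ> seq_of f)"

context
  fixes A :: "'d \<Rightarrow> 'd" and C :: real
  assumes A: "linear_map D D A"
    and bound: "\<forall>x\<in>D. hnorm s (A x) \<le> C * hnorm s x"
begin

lemma lift_norm_le:
  assumes \<sigma>: "\<sigma> \<in> cauchy_seqs"
  shows "hnorm limit_form (A \<circ> \<sigma>) \<le> C * hnorm limit_form \<sigma>"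
proof -
  have lim: "(\<lambda>n. hnorm s (\<tau> n)) \<longlonglongrightarrow> hnorm limit_form \<tau>" if "\<tau> \<in> cauchy_seqs" for \<tau>
    unfolding hnorm_def using that by (intro tendsto_intros limit_form_tendsto)
  show ?thesis
    using lim[OF cauchy_seqs_image[OF A bound \<sigma>]] tendsto_mult_left[OF lim[OF \<sigma>], of C]
    by (rule LIMSEQ_le) (use bound \<sigma> in auto)
qed

text \<open>Two representatives differ by a null sequence, and the bound on \<open>A\<close> sends
  null sequences to null sequences.\<close>

lemma lift_rep:
  assumes \<sigma>: "\<sigma> \<in> cauchy_seqs"
  shows "lift A (rep \<sigma>) = rep (A \<circ> \<sigma>)"
proof -
  let ?\<delta> = "seq_of (rep \<sigma>) - \<sigma>"
  have m: "seq_of (rep \<sigma>) \<in> cauchy_seqs" "rep (seq_of (rep \<sigma>)) = rep \<sigma>"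
    using \<sigma> by (auto intro: seq_of rep_mem)
  note img = cauchy_seqs_image[OF A bound]
  have \<delta>: "?\<delta> \<in> cauchy_seqs" using m \<sigma> by simp
  have "rep ?\<delta> = 0" using m \<sigma> by (simp add: rep_diff)
  then have "hnorm limit_form ?\<delta> = 0" using \<delta> by (simp add: rep_eq_zero_iff hnorm_def)
  then have "hnorm limit_form (A \<circ> ?\<delta>) = 0"
    using lift_norm_le[OF \<delta>] L.hnorm_nonneg[OF img[OF \<delta>]] by simp
  then have "rep (A \<circ> ?\<delta>) = 0" using img[OF \<delta>] by (simp add: rep_eq_zero_iff hnorm_def)
  moreover have "A \<circ> ?\<delta> = (A \<circ> seq_of (rep \<sigma>)) - (A \<circ> \<sigma>)"
    using m \<sigma> by (simp add: fun_eq_iff linear_map_diff[OF A subspace_D])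
  ultimately show ?thesis
    using img[OF m(1)] img[OF \<sigma>] by (simp add: lift_def rep_diff)
qed

lemma lift_bounded: "lift A \<in> bounded_operators completion_space completion_form completion_space completion_form"
  unfolding bounded_operators_def
proof (intro CollectI conjI ballI allI)
  note img = cauchy_seqs_image[OF A bound]
  show "lift A x \<in> completion_space" if "x \<in> completion_space" for x
    using that by (elim completionE) (simp add: lift_rep rep_mem img)
  show "lift A (x + y) = lift A x + lift A y" if xy: "x \<in> completion_space" "y \<in> completion_space" for x y
  proof -
    obtain \<sigma> where x: "\<sigma> \<in> cauchy_seqs" "x = rep \<sigma>" using xy(1) by (rule completionE)
    obtain \<tau> where y: "\<tau> \<in> cauchy_seqs" "y = rep \<tau>" using xy(2) by (rule completionE)
    note * = x y
    have "A \<circ> (\<sigma> + \<tau>) = (A \<circ> \<sigma>) + (A \<circ> \<tau>)"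
      using * by (simp add: fun_eq_iff linear_map_add[OF A])
    then show ?thesis
      using * by (simp add: lift_rep img flip: rep_add)
  qed
  show "lift A (c *\<^sub>C x) = c *\<^sub>C lift A x" if x: "x \<in> completion_space" for c x
  proof -
    obtain \<sigma> where *: "\<sigma> \<in> cauchy_seqs" "x = rep \<sigma>"
      using x by (rule completionE)
    then have "A \<circ> (c *\<^sub>C \<sigma>) = c *\<^sub>C (A \<circ> \<sigma>)"
      by (simp add: fun_eq_iff scaleC_fun_def linear_map_scale[OF A])
    then show ?thesis
      using * by (simp add: lift_rep img flip: rep_scale)
  qed
  show "\<exists>C. \<forall>x\<in>completion_space. hnorm completion_form (lift A x) \<le> C * hnorm completion_form x"
    using lift_norm_le
    by (intro exI[of _ C] ballI) (elim completionE, simp add: lift_rep hnorm_rep img)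
qed

end

text \<open>Normality refers to \<open>hadjoint\<close>, which by uniqueness of adjoints coincides
  with \<open>lift B\<close> on the completion; the commutation relation passes over
  termwise.\<close>

theorem lift_normal:
  assumes A: "linear_map D D A" "\<forall>x\<in>D. hnorm s (A x) \<le> C * hnorm s x"
    and B: "linear_map D D B" "\<forall>x\<in>D. hnorm s (B x) \<le> C' * hnorm s x"
    and adj: "\<And>x y. x \<in> D \<Longrightarrow> y \<in> D \<Longrightarrow> s (A x) y = s x (B y)"
    and comm: "\<And>x. x \<in> D \<Longrightarrow> A (B x) = B (A x)"
  shows "normal_operator completion_space completion_form (lift A)"
proof -
  interpret K: complex_hilbert_space completion_space completion_form by (rule completion_hilbert)
  let ?N = "hadjoint completion_space completion_form completion_space completion_form (lift A)"
  note bA = lift_bounded[OF A] and bB = lift_bounded[OF B]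
  note rA = lift_rep[OF A] and rB = lift_rep[OF B]
  note iA = cauchy_seqs_image[OF A] and iB = cauchy_seqs_image[OF B]
  note N = hadjoint_spec[OF completion_hilbert completion_hilbert bA]
  have lift_adj: "completion_form (lift A x) y = completion_form x (lift B y)"
    if xy: "x \<in> completion_space" "y \<in> completion_space" for x y
  proof -
    obtain \<sigma> where x: "\<sigma> \<in> cauchy_seqs" "x = rep \<sigma>" using xy(1) by (rule completionE)
    obtain \<tau> where y: "\<tau> \<in> cauchy_seqs" "y = rep \<tau>" using xy(2) by (rule completionE)
    note * = x y
    have "limit_form (A \<circ> \<sigma>) \<tau> = limit_form \<sigma> (B \<circ> \<tau>)"
      using * limit_form_tendsto[OF *(1) iB[OF *(3)]]
      by (intro limit_form_unique iA) (simp_all add: adj)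
    then show ?thesis using * by (simp add: rA rB iA iB completion_form_rep)
  qed
  have N_eq: "?N y = lift B y" if y: "y \<in> completion_space" for y
    using y linear_map_mem[OF bounded_operators_linear_map[OF N(1)] y]
      linear_map_mem[OF bounded_operators_linear_map[OF bB] y]
    by (intro K.ip_eq_imp_eq) (simp_all add: lift_adj flip: N(2))
  have lift_comm: "lift B (lift A x) = lift A (lift B x)" if x: "x \<in> completion_space" for x
  proof -
    obtain \<sigma> where *: "\<sigma> \<in> cauchy_seqs" "x = rep \<sigma>"
      using x by (rule completionE)
    then have "B \<circ> (A \<circ> \<sigma>) = A \<circ> (B \<circ> \<sigma>)" by (simp add: fun_eq_iff comm)
    then show ?thesis using * by (simp add: rA rB iA iB)
  qed
  show ?thesis
    unfolding normal_operator_def Let_def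
    using bA lift_comm N_eq linear_map_mem[OF bounded_operators_linear_map[OF bA]] by simp
qed

end

section \<open>The Bram--Halmos construction of a normal extension\<close>

text \<open>Log-convexity makes the ratios of successive terms nondecreasing, so a first ratio above
  1 would force geometric growth. It is applied to squared norms along an orbit of the
  extension.\<close>

lemma log_convex_bounded_imp_le:
  fixes a :: "nat \<Rightarrow> real"
  assumes nonneg: "\<And>n. 0 \<le> a n" and convex: "\<And>n. (a (Suc n))\<^sup>2 \<le> a n * a (Suc (Suc n))"
    and bounded: "\<And>n. a n \<le> M"
  shows "a 1 \<le> a 0"
proof (rule ccontr)
  assume "\<not> a 1 \<le> a 0"
  then have less: "a 0 < a 1" by simp
  have a0: "0 < a 0"
  proof (rule ccontr)
    assume "\<not> 0 < a 0"
    then have "a 0 = 0" using nonneg[of 0] by simp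
    then show False using convex[of 0] less by simp
  qed
  define r where "r = a 1 / a 0"
  have r: "1 < r" using less a0 by (simp add: r_def)
  have step: "0 < a n \<and> r * a n \<le> a (Suc n)" for n
  proof (induction n)
    case 0
    then show ?case using a0 by (simp add: r_def)
  next
    case (Suc n)
    then have pos: "0 < a (Suc n)" using r by (smt (verit) mult_pos_pos)
    have "a n * (r * a (Suc n)) \<le> a (Suc n) * a (Suc n)"
      using Suc pos by (simp add: mult.left_commute mult.assoc[symmetric] mult_right_mono)
    also have "\<dots> \<le> a n * a (Suc (Suc n))" using convex[of n] by (simp add: power2_eq_square)
    finally show ?case using Suc pos by (simp add: mult_le_cancel_left)
  qed
  have "r ^ n * a 0 \<le> a n" for n
  proof (induction n)
    case (Suc n)
    have "r ^ Suc n * a 0 \<le> r * a n" using Suc r by (simp add: mult.assoc)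
    then show ?case using step[of n] by linarith
  qed simp
  then have le: "r ^ n \<le> M / a 0" for n
    using bounded[of n] a0 by (simp add: pos_le_divide_eq) (meson order_trans)
  obtain n where "M / a 0 < r ^ n" using real_arch_pow[OF r] by blast
  then show False using le[of n] by simp
qed

locale bram_halmos = linear_contraction H ip T for H :: "'v::complex_vector set" and ip T +
  assumes kernel_nonneg:
    "(\<And>i. h i \<in> H) \<Longrightarrow> 0 \<le> Re (\<Sum>i<n::nat. \<Sum>j<n. ip ((T ^^ i) (h j)) ((T ^^ j) (h i)))"
begin

definition finite_seqs :: "(nat \<Rightarrow> 'v) set" where
  "finite_seqs = {d. (\<forall>i. d i \<in> H) \<and> (\<exists>n. \<forall>i\<ge>n. d i = 0)}"

text \<open>
  The sequence \<open>d\<close> stands for the vector \<open>\<Sum>i. N*^i (d i)\<close>, where \<open>N\<close> is the normal extension to be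
  constructed; its inner products are forced by the normality of \<open>N\<close>.
\<close>

definition kernel_form :: "(nat \<Rightarrow> 'v) \<Rightarrow> (nat \<Rightarrow> 'v) \<Rightarrow> complex" where
  "kernel_form d e = (\<Sum>i | d i \<noteq> 0. \<Sum>j | e j \<noteq> 0. ip ((T ^^ j) (d i)) ((T ^^ i) (e j)))"

lemma finite_seqs_mem [simp]: "d \<in> finite_seqs \<Longrightarrow> d i \<in> H"
  by (simp add: finite_seqs_def)

lemma finite_seqs_bound:
  assumes "d \<in> finite_seqs"
  shows "\<exists>n. \<forall>i\<ge>n. d i = 0"
  using assms unfolding finite_seqs_def by blast

lemma finite_seqsI: "\<lbrakk>\<And>i. d i \<in> H; \<And>i. i \<ge> n \<Longrightarrow> d i = 0\<rbrakk> \<Longrightarrow> d \<in> finite_seqs"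
  unfolding finite_seqs_def by blast

lemma T_pow_zero [simp]: "(T ^^ n) 0 = 0"
  by (rule linear_map_zero[OF T_pow subspace_D])

lemma T_zero [simp]: "T 0 = 0"
  by (rule linear_map_zero[OF T subspace_D])

text \<open>The supports in the definition vary with the arguments, which hides additivity; over any
  common range the additional terms vanish.\<close>

lemma kernel_form_eq:
  assumes d: "d \<in> finite_seqs" and e: "e \<in> finite_seqs"
    and dn: "\<And>i. i \<ge> n \<Longrightarrow> d i = 0" and en: "\<And>i. i \<ge> n \<Longrightarrow> e i = 0"
  shows "kernel_form d e = (\<Sum>i<n. \<Sum>j<n. ip ((T ^^ j) (d i)) ((T ^^ i) (e j)))"
proof -
  have sub: "{i. d i \<noteq> 0} \<subseteq> {..<n}" "{i. e i \<noteq> 0} \<subseteq> {..<n}"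
    using dn en by (auto simp: not_less[symmetric])
  have "(\<Sum>j | e j \<noteq> 0. ip ((T ^^ j) (d i)) ((T ^^ i) (e j)))
      = (\<Sum>j<n. ip ((T ^^ j) (d i)) ((T ^^ i) (e j)))" for i
    using sub d by (intro sum.mono_neutral_left) auto
  then have "kernel_form d e = (\<Sum>i | d i \<noteq> 0. \<Sum>j<n. ip ((T ^^ j) (d i)) ((T ^^ i) (e j)))"
    by (simp add: kernel_form_def)
  also have "\<dots> = (\<Sum>i<n. \<Sum>j<n. ip ((T ^^ j) (d i)) ((T ^^ i) (e j)))"
    using sub e by (intro sum.mono_neutral_left) auto
  finally show ?thesis .
qed

lemma common_bound:
  assumes "d \<in> finite_seqs" "e \<in> finite_seqs"
  obtains n where "\<And>i. i \<ge> n \<Longrightarrow> d i = 0" "\<And>i. i \<ge> n \<Longrightarrow> e i = 0"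
proof -
  obtain m k where "\<forall>i\<ge>m. d i = 0" "\<forall>i\<ge>k. e i = 0"
    using finite_seqs_bound assms by metis
  then show ?thesis by (intro that[of "max m k"]) simp_all
qed

lemma subspace_finite_seqs: "complex_vector.subspace finite_seqs"
  unfolding complex_vector.subspace_def
proof (intro conjI ballI allI)
  show "0 \<in> finite_seqs" by (rule finite_seqsI[of _ 0]) simp_all
  show "d + e \<in> finite_seqs" if de: "d \<in> finite_seqs" "e \<in> finite_seqs" for d e
  proof -
    obtain n where "\<And>i. i \<ge> n \<Longrightarrow> d i = 0" "\<And>i. i \<ge> n \<Longrightarrow> e i = 0"
      using common_bound[OF de] by blast
    then show ?thesis using that by (intro finite_seqsI[of _ n]) simp_all
  qed
  show "c *\<^sub>C d \<in> finite_seqs" if d: "d \<in> finite_seqs" for c d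
  proof -
    obtain n where "\<forall>i\<ge>n. d i = 0" using finite_seqs_bound[OF d] by blast
    then show ?thesis using that by (intro finite_seqsI[of _ n]) (simp_all add: scaleC_fun_def)
  qed
qed

sublocale K: semi_inner_space finite_seqs kernel_form
proof
  fix x y z c assume x: "x \<in> finite_seqs" and y: "y \<in> finite_seqs"
  obtain n where n: "\<And>i. i \<ge> n \<Longrightarrow> x i = 0" "\<And>i. i \<ge> n \<Longrightarrow> y i = 0"
    using common_bound[OF x y] by blast
  have cx: "c *\<^sub>C x \<in> finite_seqs"
    using x by (rule complex_vector.subspace_scale[OF subspace_finite_seqs])
  have "kernel_form (c *\<^sub>C x) y
      = (\<Sum>i<n. \<Sum>j<n. ip ((T ^^ j) ((c *\<^sub>C x) i)) ((T ^^ i) (y j)))"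
    using n by (intro kernel_form_eq cx y) (simp_all add: scaleC_fun_def)
  also have "\<dots> = c * (\<Sum>i<n. \<Sum>j<n. ip ((T ^^ j) (x i)) ((T ^^ i) (y j)))"
    using x y
    by (simp add: sum_distrib_left scaleC_fun_def linear_map_scale[OF T_pow] s_scale_left)
  also have "\<dots> = c * kernel_form x y"
    by (simp only: kernel_form_eq[OF x y n])
  finally show "kernel_form (c *\<^sub>C x) y = c * kernel_form x y" .
  have "kernel_form y x = (\<Sum>i<n. \<Sum>j<n. ip ((T ^^ j) (y i)) ((T ^^ i) (x j)))"
    by (rule kernel_form_eq[OF y x n(2,1)])
  also have "\<dots> = (\<Sum>i<n. \<Sum>j<n. cnj (ip ((T ^^ i) (x j)) ((T ^^ j) (y i))))"
    using x y by (intro sum.cong refl s_commute) simp_all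
  also have "\<dots> = (\<Sum>j<n. \<Sum>i<n. cnj (ip ((T ^^ i) (x j)) ((T ^^ j) (y i))))"
    by (rule sum.swap)
  also have "\<dots> = cnj (kernel_form x y)"
    by (simp add: kernel_form_eq[OF x y n])
  finally show "kernel_form y x = cnj (kernel_form x y)" .
  have "kernel_form x x = (\<Sum>i<n. \<Sum>j<n. ip ((T ^^ j) (x i)) ((T ^^ i) (x j)))"
    by (rule kernel_form_eq[OF x x n(1) n(1)])
  also have "\<dots> = (\<Sum>i<n. \<Sum>j<n. ip ((T ^^ i) (x j)) ((T ^^ j) (x i)))"
    by (rule sum.swap)
  finally show "0 \<le> Re (kernel_form x x)"
    using kernel_nonneg[of x n] x by simp
  assume z: "z \<in> finite_seqs"
  obtain k where k: "\<And>i. i \<ge> k \<Longrightarrow> z i = 0" "\<And>i. i \<ge> k \<Longrightarrow> z i = 0"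
    using common_bound[OF z z] by blast
  define m where "m = max n k"
  have m: "\<And>i. i \<ge> m \<Longrightarrow> x i = 0" "\<And>i. i \<ge> m \<Longrightarrow> y i = 0" "\<And>i. i \<ge> m \<Longrightarrow> z i = 0"
    using n k by (simp_all add: m_def)
  have "kernel_form (x + y) z = (\<Sum>i<m. \<Sum>j<m. ip ((T ^^ j) ((x + y) i)) ((T ^^ i) (z j)))"
    using m x y z
    by (intro kernel_form_eq complex_vector.subspace_add[OF subspace_finite_seqs]) simp_all
  then show "kernel_form (x + y) z = kernel_form x z + kernel_form y z"
    using x y z
    by (simp add: kernel_form_eq[OF x z m(1,3)] kernel_form_eq[OF y z m(2,3)]
        linear_map_add[OF T_pow] s_add_left sum.distrib)
qed (rule subspace_finite_seqs)

section \<open>The future normal operator and its adjoint on finite sequences\<close>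

text \<open>Acts as \<open>N*\<close> on the vector that the sequence stands for: every exponent
  rises by one.\<close>

definition shift :: "(nat \<Rightarrow> 'v) \<Rightarrow> nat \<Rightarrow> 'v" where
  "shift d = case_nat 0 d"

lemma shift_simps [simp]: "shift d 0 = 0" "shift d (Suc i) = d i"
  by (simp_all add: shift_def)

text \<open>Entrywise application of \<open>T\<close> acts as \<open>N\<close>, because
  \<open>N\<close> is to commute with \<open>N*\<close> and to extend \<open>T\<close>.\<close>

lemma linear_map_comp_T: "linear_map finite_seqs finite_seqs ((\<circ>) T)"
  unfolding linear_map_def
proof (intro conjI ballI allI)
  show "T \<circ> d \<in> finite_seqs" if d: "d \<in> finite_seqs" for d
  proof -
    obtain n where "\<forall>i\<ge>n. d i = 0" using finite_seqs_bound[OF d] by blast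
    then show ?thesis using that by (intro finite_seqsI[of _ n]) simp_all
  qed
qed (simp_all add: fun_eq_iff scaleC_fun_def linear_map_add[OF T] linear_map_scale[OF T])

lemma linear_map_shift: "linear_map finite_seqs finite_seqs shift"
  unfolding linear_map_def
proof (intro conjI ballI allI)
  show "shift d \<in> finite_seqs" if d: "d \<in> finite_seqs" for d
  proof -
    obtain n where "\<forall>i\<ge>n. d i = 0" using finite_seqs_bound[OF d] by blast
    then show ?thesis
      using that by (intro finite_seqsI[of _ "Suc n"]) (auto simp: shift_def split: nat.split)
  qed
qed (auto simp: fun_eq_iff scaleC_fun_def shift_def split: nat.split)

lemmas comp_T_mem [simp] = linear_map_mem[OF linear_map_comp_T]
lemmas shift_mem [simp] = linear_map_mem[OF linear_map_shift]

lemma comp_T_shift: "T \<circ> shift d = shift (T \<circ> d)"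
  by (auto simp: fun_eq_iff shift_def split: nat.split)

lemma kernel_form_adj:
  assumes d: "d \<in> finite_seqs" and e: "e \<in> finite_seqs"
  shows "kernel_form (T \<circ> d) e = kernel_form d (shift e)"
proof -
  obtain n where n: "\<And>i. i \<ge> n \<Longrightarrow> d i = 0" "\<And>i. i \<ge> n \<Longrightarrow> e i = 0"
    using common_bound[OF d e] by blast
  have se: "shift e i = 0" if "i \<ge> Suc n" for i
    using n(2)[of "i - 1"] that by (cases i) simp_all
  have "kernel_form (T \<circ> d) e = (\<Sum>i<n. \<Sum>j<n. ip ((T ^^ j) (T (d i))) ((T ^^ i) (e j)))"
    using n d e by (subst kernel_form_eq[where n = n]) simp_all
  also have "\<dots> = (\<Sum>i<n. \<Sum>j<n. ip ((T ^^ Suc j) (d i)) ((T ^^ i) (shift e (Suc j))))"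
    by (simp add: funpow_swap1)
  \<comment> \<open>The new column \<open>j = 0\<close> vanishes since \<open>shift e 0 = 0\<close>;
    the row \<open>i = n\<close> added next vanishes since \<open>d n = 0\<close>.\<close>
  also have "\<dots> = (\<Sum>i<n. \<Sum>j<Suc n. ip ((T ^^ j) (d i)) ((T ^^ i) (shift e j)))"
    using d by (subst sum.lessThan_Suc_shift) simp
  also have "\<dots> = (\<Sum>i<Suc n. \<Sum>j<Suc n. ip ((T ^^ j) (d i)) ((T ^^ i) (shift e j)))"
    using n(1)[of n] e by (subst (2) sum.lessThan_Suc) (simp del: sum.lessThan_Suc)
  also have "\<dots> = kernel_form d (shift e)"
    using d e n se by (intro kernel_form_eq[symmetric]) simp_all
  finally show ?thesis .
qed

text \<open>Let \<open>a k\<close> be the squared norm of N^k d. It is the pairing of N^(k-1) d with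
  \<open>N*\<close> N^k d, and \<open>N*\<close> and \<open>N\<close> give N^k d the same norm; so
  Cauchy-Schwarz yields log-convexity of \<open>a\<close>, while contractivity of \<open>T\<close>
  on \<open>H\<close> bounds it.\<close>

lemma comp_T_contraction:
  assumes d: "d \<in> finite_seqs"
  shows "Re (kernel_form (T \<circ> d) (T \<circ> d)) \<le> Re (kernel_form d d)"
proof -
  define x where "x k = (((\<circ>) T) ^^ k) d" for k
  have x: "x k \<in> finite_seqs" for k
    unfolding x_def by (rule linear_map_mem[OF linear_map_funpow[OF linear_map_comp_T] d])
  have x_Suc: "x (Suc k) = T \<circ> x k" for k by (simp add: x_def)
  have x_eq: "x k i = (T ^^ k) (d i)" for k i
    by (induction k) (simp_all add: x_def)
  define a where "a k = Re (kernel_form (x k) (x k))" for k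
  obtain n where n: "\<And>i. i \<ge> n \<Longrightarrow> d i = 0" "\<And>i. i \<ge> n \<Longrightarrow> d i = 0"
    using common_bound[OF d d] by blast
  have "a 1 \<le> a 0"
  proof (rule log_convex_bounded_imp_le)
    fix k
    show "0 \<le> a k" unfolding a_def by (rule K.s_nonneg[OF x])
    have eq: "kernel_form (shift (x (Suc k))) (shift (x (Suc k)))
        = kernel_form (x (Suc (Suc k))) (x (Suc (Suc k)))"
    proof -
      have "kernel_form (shift (x (Suc k))) (shift (x (Suc k)))
          = kernel_form (shift (T \<circ> x (Suc k))) (x (Suc k))"
        using x by (simp add: comp_T_shift flip: kernel_form_adj)
      also have "\<dots> = cnj (kernel_form (x (Suc k)) (shift (x (Suc (Suc k)))))"
        unfolding x_Suc[of "Suc k", symmetric] by (intro K.s_commute shift_mem x)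
      also have "\<dots> = cnj (kernel_form (T \<circ> x (Suc k)) (x (Suc (Suc k))))"
        by (simp only: kernel_form_adj x)
      also have "\<dots> = kernel_form (x (Suc (Suc k))) (x (Suc (Suc k)))"
        unfolding x_Suc[of "Suc k", symmetric] by (rule K.s_commute[symmetric]) (rule x)+
      finally show ?thesis .
    qed
    have "kernel_form (x (Suc k)) (x (Suc k)) = kernel_form (x k) (shift (x (Suc k)))"
      using x by (simp add: x_Suc kernel_form_adj)
    then have "a (Suc k) \<le> cmod (kernel_form (x k) (shift (x (Suc k))))"
      unfolding a_def by (metis complex_Re_le_cmod)
    then have "(a (Suc k))\<^sup>2 \<le> (cmod (kernel_form (x k) (shift (x (Suc k)))))\<^sup>2"
      by (rule power_mono) (simp add: a_def K.s_nonneg x)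
    also have "\<dots> \<le> a k * a (Suc (Suc k))"
      using K.cauchy_schwarz_sq[OF x[of k] shift_mem[OF x[of "Suc k"]]] by (simp add: a_def eq)
    finally show "(a (Suc k))\<^sup>2 \<le> a k * a (Suc (Suc k))" .
    have norm_pow: "hnorm ip ((T ^^ m) h) \<le> hnorm ip h" if "h \<in> H" for m h
      unfolding hnorm_def using contraction_pow[OF that] by simp
    have norm_pow2: "hnorm ip ((T ^^ m) ((T ^^ k) h)) \<le> hnorm ip h" if "h \<in> H" for m h
      using norm_pow[of "(T ^^ k) h" m] norm_pow[OF that, of k] that by simp
    \<comment> \<open>The powers of \<open>T\<close> only shrink the finitely many entries of
      \<open>d\<close>, so the bound does not depend on \<open>k\<close>.\<close>
    have "kernel_form (x k) (x k)
        = (\<Sum>i<n. \<Sum>j<n. ip ((T ^^ j) ((T ^^ k) (d i))) ((T ^^ i) ((T ^^ k) (d j))))"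
      using n(1) by (subst kernel_form_eq[OF x x, where n = n]) (simp_all add: x_eq)
    also have "cmod \<dots> \<le> (\<Sum>i<n. \<Sum>j<n. hnorm ip (d i) * hnorm ip (d j))"
    proof (intro sum_norm_le)
      fix i j
      have "cmod (ip ((T ^^ j) ((T ^^ k) (d i))) ((T ^^ i) ((T ^^ k) (d j))))
          \<le> hnorm ip ((T ^^ j) ((T ^^ k) (d i))) * hnorm ip ((T ^^ i) ((T ^^ k) (d j)))"
        using d by (intro cauchy_schwarz) simp_all
      also have "\<dots> \<le> hnorm ip (d i) * hnorm ip (d j)"
        using d by (intro mult_mono norm_pow2) (simp_all add: hnorm_nonneg)
      finally show "cmod (ip ((T ^^ j) ((T ^^ k) (d i))) ((T ^^ i) ((T ^^ k) (d j))))
          \<le> hnorm ip (d i) * hnorm ip (d j)" .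
    qed
    finally show "a k \<le> (\<Sum>i<n. \<Sum>j<n. hnorm ip (d i) * hnorm ip (d j))"
      unfolding a_def using complex_Re_le_cmod order_trans by blast
  qed
  then show ?thesis by (simp add: a_def x_def)
qed

text \<open>The norm form of normality; it carries the contraction bound over to
  \<open>shift\<close>.\<close>

lemma shift_norm:
  assumes d: "d \<in> finite_seqs"
  shows "kernel_form (shift d) (shift d) = kernel_form (T \<circ> d) (T \<circ> d)"
proof -
  have "kernel_form (shift d) (shift d) = kernel_form (shift (T \<circ> d)) d"
    using d by (simp add: comp_T_shift flip: kernel_form_adj)
  also have "\<dots> = cnj (kernel_form d (shift (T \<circ> d)))"
    using d by (intro K.s_commute) simp_all
  also have "\<dots> = cnj (kernel_form (T \<circ> d) (T \<circ> d))"
    using d by (simp add: kernel_form_adj)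
  also have "\<dots> = kernel_form (T \<circ> d) (T \<circ> d)"
    using d by (intro K.s_commute[symmetric]) simp_all
  finally show ?thesis .
qed

section \<open>Embedding of H and the normal extension\<close>

text \<open>Stands for the n-th power of \<open>N*\<close> applied to \<open>h\<close>. Returning 0
  outside \<open>H\<close> makes the family total in \<open>h :: 'v\<close>, so the completion
  consists of functions \<open>nat \<Rightarrow> 'v \<Rightarrow> complex\<close>, the type demanded
  of the extension space.\<close>

definition single :: "nat \<Rightarrow> 'v \<Rightarrow> nat \<Rightarrow> 'v" where
  "single n h = (\<lambda>i. if i = n \<and> h \<in> H then h else 0)"

lemma single_mem [simp]: "single n h \<in> finite_seqs"
  by (rule finite_seqsI[of _ "Suc n"]) (simp_all add: single_def)

sublocale K: generated_semi_inner_space finite_seqs kernel_form single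
proof
  show "finite_seqs \<subseteq> complex_vector.span (\<Union>i. range (single i))"
  proof
    fix d assume d: "d \<in> finite_seqs"
    obtain n where n: "\<forall>i\<ge>n. d i = 0" using finite_seqs_bound[OF d] by blast
    have sum_apply: "(\<Sum>i\<in>I. single i (d i)) k = (\<Sum>i\<in>I. single i (d i) k)" for I k
      by (induction I rule: infinite_finite_induct) simp_all
    have "d k = (\<Sum>i<n. single i (d i)) k" for k
      unfolding sum_apply using n d by (simp add: single_def)
    then have "d = (\<Sum>i<n. single i (d i))" by (rule ext)
    moreover have "(\<Sum>i<n. single i (d i)) \<in> complex_vector.span (\<Union>i. range (single i))"
      by (intro complex_vector.span_sum complex_vector.span_base) blast
    ultimately show "d \<in> complex_vector.span (\<Union>i. range (single i))" by simp
  qed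
qed (rule single_mem)

lemma kernel_form_single:
  assumes "h \<in> H" "h' \<in> H"
  shows "kernel_form (single 0 h) (single 0 h') = ip h h'"
  using assms by (subst kernel_form_eq[OF single_mem single_mem, of 1]) (simp_all add: single_def)

theorem normal_extension:
  assumes bounded: "T \<in> bounded_operators H ip H ip"
  shows "subnormal_operator H ip T"
proof -
  \<comment> \<open>Entry 0 carries the zeroth power of \<open>N*\<close>, hence \<open>h\<close>
    itself.\<close>
  define J where "J h = K.rep (\<lambda>_. single 0 h)" for h
  have single_add: "single 0 (h + h') = single 0 h + single 0 h'" if "h \<in> H" "h' \<in> H" for h h'
    using that by (simp add: single_def fun_eq_iff)
  have single_scale: "single 0 (c *\<^sub>C h) = c *\<^sub>C single 0 h" if "h \<in> H" for c h
    using that by (simp add: single_def fun_eq_iff scaleC_fun_def)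
  have single_T: "single 0 (T h) = T \<circ> single 0 h" if "h \<in> H" for h
    using that by (simp add: single_def fun_eq_iff)
  have const: "(\<lambda>_. single 0 h) \<in> K.cauchy_seqs" for h by simp
  have J_form: "K.completion_form (J h) (J h') = ip h h'" if "h \<in> H" "h' \<in> H" for h h'
    using that by (simp add: J_def K.completion_form_rep kernel_form_single)
  have "J \<in> bounded_operators H ip K.completion_space K.completion_form"
    unfolding bounded_operators_def
  proof (intro CollectI conjI ballI allI)
    show "J h \<in> K.completion_space" for h by (simp add: J_def K.rep_mem)
    show "J (h + h') = J h + J h'" if "h \<in> H" "h' \<in> H" for h h'
    proof -
      have "(\<lambda>_::nat. single 0 (h + h')) = (\<lambda>_. single 0 h) + (\<lambda>_. single 0 h')"
        using that by (simp add: single_add fun_eq_iff)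
      then show ?thesis by (simp add: J_def K.rep_add)
    qed
    show "J (c *\<^sub>C h) = c *\<^sub>C J h" if "h \<in> H" for c h
    proof -
      have "(\<lambda>_::nat. single 0 (c *\<^sub>C h)) = c *\<^sub>C (\<lambda>_. single 0 h)"
        using that by (simp add: single_scale scaleC_fun_def)
      then show ?thesis by (simp add: J_def K.rep_scale)
    qed
    show "\<exists>C. \<forall>h\<in>H. hnorm K.completion_form (J h) \<le> C * hnorm ip h"
      by (intro exI[of _ 1]) (simp add: hnorm_def J_form)
  qed
  then have iso: "isometric_embedding H ip K.completion_space K.completion_form J"
    by (simp add: isometric_embedding_def J_form)
  have bT: "\<forall>d\<in>finite_seqs. hnorm kernel_form (T \<circ> d) \<le> 1 * hnorm kernel_form d"
    by (simp add: hnorm_def comp_T_contraction)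
  have bS: "\<forall>d\<in>finite_seqs. hnorm kernel_form (shift d) \<le> 1 * hnorm kernel_form d"
    by (simp add: hnorm_def shift_norm comp_T_contraction)
  have normal: "normal_operator K.completion_space K.completion_form (K.lift ((\<circ>) T))"
    using kernel_form_adj comp_T_shift
    by (intro K.lift_normal[OF linear_map_comp_T bT linear_map_shift bS])
  have "J (T h) = K.lift ((\<circ>) T) (J h)" if "h \<in> H" for h
    using that by (simp add: J_def K.lift_rep[OF linear_map_comp_T bT const] single_T o_def)
  then show ?thesis
    unfolding subnormal_operator_def using bounded K.completion_hilbert iso normal by blast
qed

end

theorem corollary5p2:
  fixes H :: "'a::complex_vector set"
    and ip :: "'a \<Rightarrow> 'a \<Rightarrow> complex"
    and T :: "'a \<Rightarrow> 'a"
  assumes "complex_hilbert_space H ip"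
    and "T \<in> bounded_operators H ip H ip"
    and "class_Q H ip T"
    and "operator_le H ip (\<lambda>x. hadjoint H ip H ip T (T x)) (\<lambda>x. x)"
  shows "subnormal_operator H ip T"
proof -
  interpret complex_hilbert_space H ip by (rule assms(1))
  note lin = bounded_operators_linear_map[OF assms(2)]
  note adj = hadjoint_spec[OF assms(1,1,2)]
  have con: "linear_contraction H ip T"
  proof (unfold_locales, rule lin)
    fix x assume x: "x \<in> H"
    let ?T' = "hadjoint H ip H ip T"
    have Tx: "T x \<in> H" using lin x by (rule linear_map_mem)
    have T'Tx: "?T' (T x) \<in> H"
      using bounded_operators_linear_map[OF adj(1)] Tx by (rule linear_map_mem)
    have "ip (x - ?T' (T x)) x \<in> \<real>\<^sub>\<ge>\<^sub>0"
      using assms(4) x by (simp add: operator_le_def positive_operator_def)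
    then have "0 \<le> Re (ip (x - ?T' (T x)) x)" by (simp add: complex_nonneg_Reals_iff)
    also have "\<dots> = Re (ip x x) - Re (ip (?T' (T x)) x)"
      using x T'Tx by (simp add: s_diff_left)
    also have "Re (ip (?T' (T x)) x) = Re (ip (T x) (T x))"
      using s_commute[OF x T'Tx] adj(2)[OF x Tx] by simp
    finally show "Re (ip (T x) (T x)) \<le> Re (ip x x)" by simp
  qed
  interpret bram_halmos H ip T
  proof (intro bram_halmos.intro con bram_halmos_axioms.intro)
    show "0 \<le> Re (\<Sum>i<n. \<Sum>j<n. ip ((T ^^ i) (h j)) ((T ^^ j) (h i)))"
      if "\<And>i. h i \<in> H" for h and n :: nat
      using assms(1) con assms(3) that by (rule class_Q_kernel_nonneg)
  qed
  show ?thesis using assms(2) by (rule normal_extension)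
qed

end
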